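(* Let $Z$ be an oriented $(2n-1)$-manifold and let $(Z\times\mathbb{R}^3,\omega)$ be a near-symplectic manifold with singular locus $Z\times\{0\}$. Let $\omega_Z$ denote the restriction of $\omega$ to $Z\cong Z\times\{0\}$. If $\varepsilon$ is a stabilizing 1-form for $\omega_Z$ on $Z$, then the normal sphere bundle $Z\times S^2$ has a stable Hamiltonian structure.
   Context: Near-symplectic forms. Let $M$ be an oriented smooth $2m$-manifold and $\omega\in\Omega^2(M)$ a closed 2-form with $\omega^m\ge 0$ everywhere. At a point $p$ let $K=K_p=\{v\in T_pM\mid \omega_p(v,\cdot)=0\}$. If $\dim K=4$, define $D_K\colon K\to\Lambda^2K^*$ by $D_K(v)=(\nabla_v\omega)_p|_{K\times K}$, the intrinsic gradient of $\omega$ at $p$ in the direction $v$, followed by restriction of 2-forms to $K$ (independent of the connection or local coordinates used to differentiate). The form $\omega$ is near-symplectic if it is closed, $\omega^m\ge0$, and at every point $p$ where $\omega^m_p=0$ the kernel $K$ is 4-dimensional and $\mathrm{Im}(D_K)$ has dimension 3. Its singular locus is $\{p\in M\mid\omega_p^{m-1}=0\}$ (equivalently, where $\omega_p^m=0$); it is a codimension 3 submanifold, and the restriction of $\omega$ to it is a Hamiltonian structure. Stable Hamiltonian structures. A Hamiltonian structure on an oriented $(2k-1)$-dimensional manifold $N$ is a closed 2-form $\Omega$ with $\Omega^{k-1}\ne0$ everywhere; $\ker(\Omega)=\{v\in TN\mid\iota_v\Omega=0\}$ is its 1-dimensional kernel distribution. A stabilizing 1-form for $\Omega$ is a 1-form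 $\lambda$ on $N$ such that (1) $\lambda\wedge\Omega^{k-1}>0$ and (2) $\ker(\Omega)\subset\ker(d\lambda)$, where $\ker(d\lambda)=\{v\in TN\mid\iota_vd\lambda=0\}$. A stable Hamiltonian structure is a pair $(\Omega,\lambda)$ consisting of a Hamiltonian structure and a stabilizing 1-form for it. *)

theory Defs
  imports
    "HOL-Analysis.Analysis"
    "HOL-Combinatorics.Permutations"
    "HOL-Library.Function_Algebras"
begin

section \<open>Smooth maps and oriented manifolds\<close>

text \<open>Meaningful for open \<open>S\<close> only, where it says that \<open>f\<close> is of class \<open>C\<^sup>k\<close>.\<close>

primrec Ck_on :: "nat \<Rightarrow> 'a::euclidean_space set \<Rightarrow> ('a \<Rightarrow> 'b::real_normed_vector) \<Rightarrow> bool" where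
  "Ck_on 0 S f \<longleftrightarrow> continuous_on S f"
| "Ck_on (Suc k) S f \<longleftrightarrow>
     (\<forall>x\<in>S. f differentiable (at x)) \<and> (\<forall>v. Ck_on k S (\<lambda>x. frechet_derivative f (at x) v))"

definition smooth_on :: "'a::euclidean_space set \<Rightarrow> ('a \<Rightarrow> 'b::real_normed_vector) \<Rightarrow> bool" where
  "smooth_on S f \<longleftrightarrow> (\<forall>k. Ck_on k S f)"

text \<open>A chart is a pair of a domain and a map that is only relevant on the domain.\<close>

type_synonym ('a, 'e) chart = "'a set \<times> ('a \<Rightarrow> 'e)"

definition coord_range :: "('a, 'e) chart \<Rightarrow> 'e set" where
  "coord_range c = snd c ` fst c"

definition transition :: "('a, 'e) chart \<Rightarrow> ('a, 'e) chart \<Rightarrow> 'e \<Rightarrow> 'e" where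
  "transition c d = snd d \<circ> inv_into (fst c) (snd c)"

text \<open>
  The model space is a Euclidean space together with an enumeration \<open>frame\<close> of its standard
  basis, that is, a copy of \<open>\<real>\<^sup>d\<close> with its coordinates in a definite order; the order is what
  fixes the orientation. The atlas need not be maximal: every notion below is invariant under
  oriented smooth coordinate changes.
\<close>

record ('a, 'e) manifold =
  mtop :: "'a topology"
  charts :: "('a, 'e) chart set"
  frame :: "nat \<Rightarrow> 'e"

text \<open>Determinant of the vectors \<open>v 0, \<dots>, v (d - 1)\<close> in the orthonormal basis
  \<open>b 0, \<dots>, b (d - 1)\<close>, where \<open>d\<close> is the dimension.\<close>

definition frame_det :: "(nat \<Rightarrow> 'e::euclidean_space) \<Rightarrow> (nat \<Rightarrow> 'e) \<Rightarrow> real" where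
  "frame_det b v =
     (\<Sum>p | p permutes {..<DIM('e)}. of_int (sign p) * (\<Prod>i<DIM('e). v i \<bullet> b (p i)))"

definition oriented_manifold :: "('a, 'e::euclidean_space) manifold \<Rightarrow> bool" where
  "oriented_manifold M \<longleftrightarrow>
     Hausdorff_space (mtop M) \<and> second_countable (mtop M) \<and>
     bij_betw (frame M) {..<DIM('e)} Basis \<and>
     (\<Union>c\<in>charts M. fst c) = topspace (mtop M) \<and>
     (\<forall>c\<in>charts M. openin (mtop M) (fst c) \<and> open (coord_range c) \<and>
        homeomorphic_map (subtopology (mtop M) (fst c)) (top_of_set (coord_range c)) (snd c)) \<and>
     (\<forall>c\<in>charts M. \<forall>d\<in>charts M.
        smooth_on (snd c ` (fst c \<inter> fst d)) (transition c d) \<and>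
        (\<forall>x\<in>snd c ` (fst c \<inter> fst d).
           frame_det (frame M) (\<lambda>i. frechet_derivative (transition c d) (at x) (frame M i)) > 0))"

text \<open>Products carry the product orientation, the first factor coming first.\<close>

definition prod_chart ::
    "('a, 'e) chart \<Rightarrow> ('b, 'f) chart \<Rightarrow> ('a \<times> 'b, 'e \<times> 'f) chart" where
  "prod_chart c d = (fst c \<times> fst d, map_prod (snd c) (snd d))"

definition prod_manifold ::
    "('a, 'e::euclidean_space) manifold \<Rightarrow> ('b, 'f::euclidean_space) manifold \<Rightarrow>
     ('a \<times> 'b, 'e \<times> 'f) manifold" (infixr \<open>\<times>\<^sub>M\<close> 80) where
  "M \<times>\<^sub>M N =
     \<lparr>mtop = prod_topology (mtop M) (mtop N),
      charts = {prod_chart c d |c d. c \<in> charts M \<and> d \<in> charts N},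
      frame = (\<lambda>i. if i < DIM('e) then (frame M i, 0) else (0, frame N (i - DIM('e))))\<rparr>"

definition R3_chart :: "(real^3, real^3) chart" where
  "R3_chart = (UNIV, \<lambda>y. y)"

definition R3 :: "(real^3, real^3) manifold" where
  "R3 = \<lparr>mtop = euclidean, charts = {R3_chart},
         frame = (\<lambda>i. [axis 1 1, axis 2 1, axis 3 1] ! i)\<rparr>"

text \<open>
  The unit sphere with the two stereographic charts, written with complex coordinates; the
  conjugation in the second chart makes the transition map \<open>w \<mapsto> 1 / w\<close>. The resulting
  orientation is the one of the sphere as boundary of the unit ball (outward normal first).
\<close>

definition S2_chart_south :: "(real^3, complex) chart" where
  "S2_chart_south =
     (sphere 0 1 - {axis 3 (-1)}, \<lambda>q. Complex (q $ 1 / (1 + q $ 3)) (q $ 2 / (1 + q $ 3)))"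

definition S2_chart_north :: "(real^3, complex) chart" where
  "S2_chart_north =
     (sphere 0 1 - {axis 3 1}, \<lambda>q. Complex (q $ 1 / (1 - q $ 3)) (- (q $ 2) / (1 - q $ 3)))"

definition S2 :: "(real^3, complex) manifold" where
  "S2 = \<lparr>mtop = top_of_set (sphere 0 1), charts = {S2_chart_south, S2_chart_north},
         frame = (\<lambda>i. [1, \<i>] ! i)\<rparr>"


section \<open>Differential forms\<close>

text \<open>
  A \<open>k\<close>-covector takes its \<open>k\<close> arguments from a sequence of vectors, of which it uses only the
  first \<open>k\<close> entries.
\<close>

type_synonym 'e covector = "(nat \<Rightarrow> 'e) \<Rightarrow> real"

definition alternating_form :: "nat \<Rightarrow> 'e::real_vector covector \<Rightarrow> bool" where
  "alternating_form k \<alpha> \<longleftrightarrow>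
     (\<forall>v w. (\<forall>i<k. v i = w i) \<longrightarrow> \<alpha> v = \<alpha> w) \<and>
     (\<forall>v. \<forall>i<k. linear (\<lambda>u. \<alpha> (v(i := u)))) \<and>
     (\<forall>v. \<forall>i<k. \<forall>j<k. i \<noteq> j \<and> v i = v j \<longrightarrow> \<alpha> v = 0)"

text \<open>Exterior product of a \<open>k\<close>-covector and an \<open>l\<close>-covector.\<close>

definition wedge :: "nat \<Rightarrow> nat \<Rightarrow> 'e covector \<Rightarrow> 'e covector \<Rightarrow> 'e covector" where
  "wedge k l \<alpha> \<beta> v =
     (\<Sum>p | p permutes {..<k + l}.
        of_int (sign p) * \<alpha> (\<lambda>i. v (p i)) * \<beta> (\<lambda>i. v (p (k + i)))) / (fact k * fact l)"

text \<open>Exterior powers of a 2-covector.\<close>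

primrec wedge_power :: "'e covector \<Rightarrow> nat \<Rightarrow> 'e covector" where
  "wedge_power \<alpha> 0 = (\<lambda>v. 1)"
| "wedge_power \<alpha> (Suc j) = wedge 2 (2 * j) \<alpha> (wedge_power \<alpha> j)"

definition vpair :: "'e \<Rightarrow> 'e \<Rightarrow> nat \<Rightarrow> 'e" where
  "vpair u w = (\<lambda>i. if i = 0 then u else w)"

definition kernel2 :: "'e covector \<Rightarrow> 'e set" where
  "kernel2 \<alpha> = {u. \<forall>w. \<alpha> (vpair u w) = 0}"

text \<open>
  A differential form on a manifold is given by its coordinate expressions in all charts of the
  atlas, as a function of the chart, the coordinate vector of the point, and the coordinates of
  the tangent vectors. The expressions are required to be related by pullback along the
  transition maps.
\<close>

type_synonym ('a, 'e) mform = "('a, 'e) chart \<Rightarrow> 'e \<Rightarrow> 'e covector"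

definition diff_form ::
    "('a, 'e::euclidean_space) manifold \<Rightarrow> nat \<Rightarrow> ('a, 'e) mform \<Rightarrow> bool" where
  "diff_form M k \<omega> \<longleftrightarrow>
     (\<forall>c\<in>charts M. (\<forall>x\<in>coord_range c. alternating_form k (\<omega> c x)) \<and>
        (\<forall>v. smooth_on (coord_range c) (\<lambda>x. \<omega> c x v))) \<and>
     (\<forall>c\<in>charts M. \<forall>d\<in>charts M. \<forall>p\<in>fst c \<inter> fst d. \<forall>v.
        \<omega> c (snd c p) v =
        \<omega> d (snd d p) (\<lambda>i. frechet_derivative (transition c d) (at (snd c p)) (v i)))"

text \<open>Exterior derivative of a \<open>k\<close>-form; the arguments are constant vector fields in the
  coordinates of the chart.\<close>

definition ext_deriv :: "nat \<Rightarrow> ('a, 'e::euclidean_space) mform \<Rightarrow> ('a, 'e) mform" where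
  "ext_deriv k \<omega> c x v =
     (\<Sum>i\<le>k. (-1) ^ i *
        frechet_derivative (\<lambda>y. \<omega> c y (\<lambda>j. v (if j < i then j else Suc j))) (at x) (v i))"

definition closed_form ::
    "('a, 'e::euclidean_space) manifold \<Rightarrow> nat \<Rightarrow> ('a, 'e) mform \<Rightarrow> bool" where
  "closed_form M k \<omega> \<longleftrightarrow>
     (\<forall>c\<in>charts M. \<forall>x\<in>coord_range c. \<forall>v. ext_deriv k \<omega> c x v = 0)"

text \<open>
  Pullback of a form along the inclusion of \<open>Z\<close> as \<open>Z \<times> {0}\<close>. In product charts this inclusion
  is the linear map \<open>x \<mapsto> (x, 0)\<close>.
\<close>

definition restrict_to_zero ::
    "('a \<times> (real^3), 'e \<times> (real^3)) mform \<Rightarrow> ('a, 'e::euclidean_space) mform" where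
  "restrict_to_zero \<omega> c x v = \<omega> (prod_chart c R3_chart) (x, 0) (\<lambda>i. (v i, 0))"


section \<open>Near-symplectic forms\<close>

text \<open>
  The intrinsic gradient at a zero of the top power. A 2-form on the subspace \<open>K\<close> is represented
  by a function on pairs of vectors that vanishes outside \<open>K \<times> K\<close>. On the kernel the derivative
  of the coefficients does not depend on the chart, after restriction to \<open>K\<close>.
\<close>

definition intrinsic_gradient ::
    "('a, 'e::euclidean_space) mform \<Rightarrow> ('a, 'e) chart \<Rightarrow> 'e \<Rightarrow> 'e \<Rightarrow> ('e \<times> 'e \<Rightarrow> real)" where
  "intrinsic_gradient \<omega> c x v =
     (\<lambda>(u, w). if u \<in> kernel2 (\<omega> c x) \<and> w \<in> kernel2 (\<omega> c x)
               then frechet_derivative (\<lambda>y. \<omega> c y (vpair u w)) (at x) v else 0)"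

text \<open>Real functions form a vector space under the pointwise operations.\<close>

interpretation rfun: vector_space "\<lambda>(r::real) (f :: 'b \<Rightarrow> real) x. r * f x"
  by unfold_locales (auto simp: fun_eq_iff algebra_simps)

definition near_symplectic ::
    "('a, 'e::euclidean_space) manifold \<Rightarrow> nat \<Rightarrow> ('a, 'e) mform \<Rightarrow> bool" where
  "near_symplectic M m \<omega> \<longleftrightarrow>
     oriented_manifold M \<and> DIM('e) = 2 * m \<and> diff_form M 2 \<omega> \<and> closed_form M 2 \<omega> \<and>
     (\<forall>c\<in>charts M. \<forall>x\<in>coord_range c.
        wedge_power (\<omega> c x) m (frame M) \<ge> 0 \<and>
        ((\<forall>v. wedge_power (\<omega> c x) m v = 0) \<longrightarrow>
           dim (kernel2 (\<omega> c x)) = 4 \<and>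
           rfun.dim (intrinsic_gradient \<omega> c x ` kernel2 (\<omega> c x)) = 3))"

definition singular_locus ::
    "('a, 'e::euclidean_space) manifold \<Rightarrow> nat \<Rightarrow> ('a, 'e) mform \<Rightarrow> 'a set" where
  "singular_locus M m \<omega> =
     {p. \<exists>c\<in>charts M. p \<in> fst c \<and> (\<forall>v. wedge_power (\<omega> c (snd c p)) (m - 1) v = 0)}"


section \<open>Stable Hamiltonian structures\<close>

definition hamiltonian_structure ::
    "('a, 'e::euclidean_space) manifold \<Rightarrow> nat \<Rightarrow> ('a, 'e) mform \<Rightarrow> bool" where
  "hamiltonian_structure N k \<Omega> \<longleftrightarrow>
     oriented_manifold N \<and> DIM('e) = 2 * k - 1 \<and> diff_form N 2 \<Omega> \<and> closed_form N 2 \<Omega> \<and>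
     (\<forall>c\<in>charts N. \<forall>x\<in>coord_range c. \<exists>v. wedge_power (\<Omega> c x) (k - 1) v \<noteq> 0)"

definition stabilizing_form ::
    "('a, 'e::euclidean_space) manifold \<Rightarrow> nat \<Rightarrow> ('a, 'e) mform \<Rightarrow> ('a, 'e) mform \<Rightarrow> bool" where
  "stabilizing_form N k \<Omega> \<mu> \<longleftrightarrow>
     diff_form N 1 \<mu> \<and>
     (\<forall>c\<in>charts N. \<forall>x\<in>coord_range c.
        wedge 1 (2 * (k - 1)) (\<mu> c x) (wedge_power (\<Omega> c x) (k - 1)) (frame N) > 0 \<and>
        kernel2 (\<Omega> c x) \<subseteq> kernel2 (ext_deriv 1 \<mu> c x))"

definition stable_hamiltonian_structure ::
    "('a, 'e::euclidean_space) manifold \<Rightarrow> nat \<Rightarrow> ('a, 'e) mform \<Rightarrow> ('a, 'e) mform \<Rightarrow> bool" where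
  "stable_hamiltonian_structure N k \<Omega> \<mu> \<longleftrightarrow>
     hamiltonian_structure N k \<Omega> \<and> stabilizing_form N k \<Omega> \<mu>"

end

theory Submission
  imports Defs
begin

text \<open>
  Let \<open>\<tau>\<close> be the restriction of \<open>\<omega>\<close> to \<open>Z\<close>, a closed 2-form, and let \<open>\<sigma>\<close> be a positive area
  form on the sphere. The structure is the product one: \<open>\<Omega> = \<pi>\<^sub>1\<^sup>*\<tau> + \<pi>\<^sub>2\<^sup>*\<sigma>\<close> and
  \<open>\<mu> = \<pi>\<^sub>1\<^sup>*\<epsilon>\<close> on \<open>Z \<times> S\<^sup>2\<close>. Both summands of \<open>\<Omega>\<close> are closed. Since \<open>\<sigma> \<and> \<sigma> = 0\<close> and
  \<open>\<tau>\<^sup>n = 0\<close> for reasons of dimension, \<open>\<Omega>\<^sup>n = n \<tau>\<^sup>n\<^sup>-\<^sup>1 \<and> \<sigma>\<close>, and therefore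
  \<open>\<mu> \<and> \<Omega>\<^sup>n = n (\<epsilon> \<and> \<tau>\<^sup>n\<^sup>-\<^sup>1) \<and> \<sigma> > 0\<close>, which makes \<open>\<Omega>\<^sup>n\<close> nonzero as well. A vector that \<open>\<Omega>\<close>
  pairs to zero with everything tangent to \<open>Z\<close> has its \<open>Z\<close>-component in \<open>ker \<tau> \<subseteq> ker d\<epsilon>\<close>, so it
  lies in \<open>ker d\<mu> = ker \<pi>\<^sub>1\<^sup>*d\<epsilon>\<close>.

  The identity for \<open>\<mu> \<and> \<Omega>\<^sup>n\<close> is needed only on the oriented frame (\<open>wedge_extra_plane\<close>). There it
  is proved without the algebra of exterior products: \<open>wedge_power_eq_sum\<close> unfolds the power
  into one sum over permutations, and \<open>sum_permutations_extra_pair\<close> counts the permutations that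
  contribute. On the sphere, everything follows from the transition between the
  stereographic charts being \<open>w \<mapsto> 1 / w\<close>: it is holomorphic, hence preserves the orientation, and it
  is an isometry of the round metric, hence \<open>\<sigma>\<close> has the same expression in both charts
  (\<open>S2_transition_conformal\<close>). Finally, products of oriented manifolds are oriented
  (\<open>oriented_manifold_prod\<close>), and exterior derivatives commute with the linear maps by which the
  inclusion of \<open>Z\<close> and the projection to \<open>Z\<close> are expressed in product charts.
\<close>

section \<open>Permutations preserving a block\<close>

definition shift_perm :: "nat \<Rightarrow> nat \<Rightarrow> (nat \<Rightarrow> nat) \<Rightarrow> nat \<Rightarrow> nat" where
  "shift_perm a b r = map_permutation {..<b} ((+) a) r"

lemma bij_betw_shift: "bij_betw ((+) a) {..<b} {a..<a + (b::nat)}"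
  by (rule bij_betwI[where g = "\<lambda>i. i - a"]) auto

lemma shift_perm_permutes:
  "r permutes {..<b} \<Longrightarrow> shift_perm a b r permutes {a..<a + b}"
  unfolding shift_perm_def by (rule map_permutation_permutes[OF bij_betw_shift])

lemma sign_shift_perm: "r permutes {..<b} \<Longrightarrow> sign (shift_perm a b r) = sign r"
  unfolding shift_perm_def by (rule sign_map_permutation) auto

lemma shift_perm_low: "r permutes {..<b} \<Longrightarrow> i < a \<Longrightarrow> shift_perm a b r i = i"
  using permutes_not_in[OF shift_perm_permutes, of r b i a] by auto

lemma shift_perm_high: "i < b \<Longrightarrow> shift_perm a b r (a + i) = a + r i"
  unfolding shift_perm_def by (rule map_permutation_apply) auto

lemma shift_perm_permutes_sum: "r permutes {..<b} \<Longrightarrow> shift_perm a b r permutes {..<a + b}"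
  by (rule permutes_subset[OF shift_perm_permutes]) auto

lemma block_perm_permutes:
  assumes "q permutes {..<a}" "r permutes {..<b}"
  shows "q \<circ> shift_perm a b r permutes {..<a + b}"
  by (rule permutes_compose[OF shift_perm_permutes_sum permutes_subset[OF assms(1)]]) (use assms in auto)

lemma sign_block_perm:
  assumes "q permutes {..<a}" "r permutes {..<b}"
  shows "sign (q \<circ> shift_perm a b r) = sign q * sign r"
  using sign_compose[OF permutes_imp_permutation[OF _ assms(1)]
      permutes_imp_permutation[OF _ shift_perm_permutes_sum[OF assms(2)]]] sign_shift_perm[OF assms(2)]
  by simp

lemma block_perm_low:
  assumes "q permutes {..<a}" "r permutes {..<b}" "i < a"
  shows "(q \<circ> shift_perm a b r) i = q i"
  using assms by (simp add: shift_perm_low)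

lemma block_perm_high:
  assumes "q permutes {..<a}" "r permutes {..<b}" "i < b"
  shows "(q \<circ> shift_perm a b r) (a + i) = a + r i"
  using assms by (simp add: shift_perm_high permutes_not_in)

text \<open>
  A permutation that preserves the lower block also preserves the upper one, so it splits uniquely
  into a permutation of each.
\<close>

lemma sum_block_permutations:
  fixes g :: "(nat \<Rightarrow> nat) \<Rightarrow> 'b::comm_monoid_add"
  shows "(\<Sum>p | p permutes {..<a + b} \<and> p ` {..<a} \<subseteq> {..<a}. g p) =
     (\<Sum>q | q permutes {..<a}. \<Sum>r | r permutes {..<b}. g (q \<circ> shift_perm a b r))"
proof -
  have "bij_betw (\<lambda>(q, r). q \<circ> shift_perm a b r) ({q. q permutes {..<a}} \<times> {r. r permutes {..<b}})
     {p. p permutes {..<a + b} \<and> p ` {..<a} \<subseteq> {..<a}}" (is "bij_betw ?f ?A ?B")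
    unfolding bij_betw_def
  proof
    show "inj_on ?f ?A"
    proof (rule inj_onI, clarify)
      fix q r q' r'
      assume p: "q permutes {..<a}" "r permutes {..<b}" "q' permutes {..<a}" "r' permutes {..<b}"
        and eq: "q \<circ> shift_perm a b r = q' \<circ> shift_perm a b r'"
      have "q i = q' i" for i
      proof (cases "i < a")
        case True
        then show ?thesis
          using fun_cong[OF eq, of i] block_perm_low[OF p(1,2)] block_perm_low[OF p(3,4)] by simp
      next
        case False
        then show ?thesis using permutes_not_in[OF p(1), of i] permutes_not_in[OF p(3), of i] by simp
      qed
      moreover have "r i = r' i" for i
      proof (cases "i < b")
        case True
        then show ?thesis using fun_cong[OF eq, of "a + i"]
            block_perm_high[OF p(1,2)] block_perm_high[OF p(3,4)] by simp
      next
        case False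
        then show ?thesis using permutes_not_in[OF p(2), of i] permutes_not_in[OF p(4), of i] by simp
      qed
      ultimately show "q = q' \<and> r = r'" by auto
    qed
    show "?f ` ?A = ?B"
    proof (rule antisym)
      show "?f ` ?A \<subseteq> ?B"
        using block_perm_permutes block_perm_low permutes_in_image by fastforce
    next
      show "?B \<subseteq> ?f ` ?A"
      proof
        fix p assume "p \<in> ?B"
        then have p: "p permutes {..<a + b}" and low: "p ` {..<a} \<subseteq> {..<a}" by auto
        have img: "p ` {..<a} = {..<a}"
          by (rule endo_inj_surj[OF _ low permutes_inj_on[OF p]]) simp
        have up: "p ` {a..<a + b} = {a..<a + b}"
        proof -
          have "{a..<a + b} = {..<a + b} - {..<a}" by auto
          then show ?thesis
            using image_set_diff[OF permutes_inj[OF p]] permutes_image[OF p] img by metis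
        qed
        let ?q = "restrict_id p {..<a}"
        let ?s = "restrict_id p {a..<a + b}"
        let ?r = "map_permutation {a..<a + b} (\<lambda>i. i - a) ?s"
        have q: "?q permutes {..<a}"
          by (rule bij_imp_permutes)
            (use img inj_eq[OF permutes_inj[OF p]] in \<open>auto simp: bij_betw_def restrict_id_def inj_on_def\<close>)
        have s: "?s permutes {a..<a + b}"
          by (rule bij_imp_permutes)
            (use up inj_eq[OF permutes_inj[OF p]] in \<open>auto simp: bij_betw_def restrict_id_def inj_on_def\<close>)
        have "bij_betw (\<lambda>i. i - a) {a..<a + b} {..<b}"
          by (rule bij_betwI[where g = "(+) a"]) auto
        then have r: "?r permutes {..<b}" by (rule map_permutation_permutes[OF _ s])
        have r_eq: "shift_perm a b ?r = ?s"
          unfolding shift_perm_def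
          by (rule map_permutation_compose_inv[OF \<open>bij_betw (\<lambda>i. i - a) _ _\<close> s]) auto
        have p_eq: "(?q \<circ> ?s) i = p i" for i
        proof (cases "i < a")
          case False
          have "i \<in> {a..<a + b} \<Longrightarrow> p i \<in> {a..<a + b}" using up by blast
          then show ?thesis using False permutes_not_in[OF p, of i]
            by (auto simp: restrict_id_def)
        qed (auto simp: restrict_id_def)
        have "?f (?q, ?r) = p"
          unfolding prod.case r_eq by (rule ext) (rule p_eq)
        moreover have "(?q, ?r) \<in> ?A" by (rule SigmaI; rule CollectI; fact)
        ultimately show "p \<in> ?f ` ?A" by (rule rev_image_eqI[OF _ sym, rotated])
      qed
    qed
  qed
  from sum.reindex_bij_betw[OF this, of g] show ?thesis
    by (simp add: sum.cartesian_product case_prod_beta)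
qed

lemma permutes_lessThan_2: "{r. r permutes {..<2::nat}} = {id, Transposition.transpose 0 1}"
proof -
  have "{..<2::nat} = {0, 1}" by auto
  then show ?thesis using permutes_doubleton_iff[of _ 0 "1::nat"] by auto
qed

lemma sum_permutations_2:
  "(\<Sum>r | r permutes {..<2::nat}. g r) = g id + g (Transposition.transpose 0 1)"
proof -
  have "id \<noteq> Transposition.transpose 0 (1::nat)"
    by (metis id_apply transpose_apply_first zero_neq_one)
  then show ?thesis unfolding permutes_lessThan_2 by simp
qed

section \<open>Exterior powers as sums over permutations\<close>

text \<open>
  When the right factor is itself an alternating sum, each inner permutation \<open>q\<close> can be absorbed
  into the outer one by the substitution of \<open>p \<circ> (id \<oplus> q)\<close> for \<open>p\<close>; the two signs cancel. Hence all
  \<open>l!\<close> inner terms contribute the same, which compensates the factor \<open>1 / l!\<close> of the exterior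
  product.
\<close>

lemma wedge_alternation:
  assumes loc: "\<And>v w. (\<And>i. i < k \<Longrightarrow> v i = w i) \<Longrightarrow> \<alpha> v = \<alpha> w"
  shows "wedge k l \<alpha> (\<lambda>v. \<Sum>q | q permutes {..<l}. of_int (sign q) * B (\<lambda>i. v (q i))) v =
    (\<Sum>p | p permutes {..<k + l}.
        of_int (sign p) * \<alpha> (\<lambda>i. v (p i)) * B (\<lambda>i. v (p (k + i)))) / fact k"
    (is "_ = ?R / _")
proof -
  let ?P = "{p. p permutes {..<k + l}}" and ?Q = "{q. q permutes {..<l}}"
  let ?G = "\<lambda>p. of_int (sign p) * \<alpha> (\<lambda>i. v (p i)) * B (\<lambda>i. v (p (k + i)))"
  let ?H = "\<lambda>p q. of_int (sign p) * \<alpha> (\<lambda>i. v (p i)) *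
             (of_int (sign q) * B (\<lambda>i. v (p (k + q i))))"
  have R: "(\<Sum>p\<in>?P. ?H p q) = ?R" if q: "q permutes {..<l}" for q
  proof -
    let ?s = "shift_perm k l q"
    have GH: "?G (p \<circ> ?s) = ?H p q" if p: "p permutes {..<k + l}" for p
    proof -
      have "sign (p \<circ> ?s) = sign p * sign q"
        using sign_compose[OF permutes_imp_permutation[OF _ p]
            permutes_imp_permutation[OF _ shift_perm_permutes_sum[OF q]]] sign_shift_perm[OF q]
        by simp
      moreover have "\<alpha> (\<lambda>i. v ((p \<circ> ?s) i)) = \<alpha> (\<lambda>i. v (p i))"
        by (rule loc) (simp add: shift_perm_low[OF q])
      moreover have "?s (k + i) = k + q i" for i
      proof (cases "i < l")
        case False
        then show ?thesis
          using permutes_not_in[OF q, of i] permutes_not_in[OF shift_perm_permutes[OF q], of "k + i" k]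
          by simp
      qed (rule shift_perm_high)
      ultimately show ?thesis by simp
    qed
    have "?R = (\<Sum>p\<in>?P. ?G (p \<circ> ?s))"
      by (rule sum_permutations_compose_right[OF shift_perm_permutes_sum[OF q]])
    also have "\<dots> = (\<Sum>p\<in>?P. ?H p q)"
      by (rule sum.cong[OF refl], rule GH) simp
    finally show ?thesis by (rule sym)
  qed
  have "wedge k l \<alpha> (\<lambda>v. \<Sum>q\<in>?Q. of_int (sign q) * B (\<lambda>i. v (q i))) v =
      (\<Sum>p\<in>?P. \<Sum>q\<in>?Q. ?H p q) / (fact k * fact l)"
    unfolding wedge_def by (simp add: sum_distrib_left)
  also have "\<dots> = (\<Sum>q\<in>?Q. \<Sum>p\<in>?P. ?H p q) / (fact k * fact l)"
    by (subst sum.swap) simp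
  also have "(\<Sum>q\<in>?Q. \<Sum>p\<in>?P. ?H p q) = fact l * ?R"
    using R by (simp add: card_permutations)
  finally show ?thesis by simp
qed

lemma wedge_divide_right: "wedge k l \<alpha> (\<lambda>v. \<beta> v / c) v = wedge k l \<alpha> \<beta> v / c"
  unfolding wedge_def by (simp add: sum_divide_distrib[symmetric] mult_ac)

text \<open>
  In this form the \<open>j\<close> factors enter symmetrically, which the recursive definition hides. It stands in
  for associativity and commutativity of the exterior product of 2-forms.
\<close>

lemma wedge_power_eq_sum:
  assumes loc: "\<And>v w. v 0 = w 0 \<Longrightarrow> v 1 = w 1 \<Longrightarrow> \<alpha> v = \<alpha> w"
  shows "wedge_power \<alpha> j = (\<lambda>v. (\<Sum>p | p permutes {..<2 * j}.
     of_int (sign p) * (\<Prod>k<j. \<alpha> (\<lambda>i. v (p (2 * k + i))))) / 2 ^ j)"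
proof (induction j)
  case 0
  then show ?case by (simp add: permutes_empty)
next
  case (Suc j)
  have "wedge_power \<alpha> (Suc j) v = (\<Sum>p | p permutes {..<2 * Suc j}.
     of_int (sign p) * (\<Prod>k<Suc j. \<alpha> (\<lambda>i. v (p (2 * k + i))))) / 2 ^ Suc j" for v
  proof -
    let ?B = "\<lambda>v. \<Prod>k<j. \<alpha> (\<lambda>i. v (2 * k + i))"
    have "wedge_power \<alpha> (Suc j) v =
        wedge 2 (2 * j) \<alpha> (\<lambda>v. \<Sum>q | q permutes {..<2 * j}. of_int (sign q) * ?B (\<lambda>i. v (q i))) v / 2 ^ j"
      by (simp only: wedge_power.simps Suc.IH wedge_divide_right)
    also have "\<dots> = (\<Sum>p | p permutes {..<2 + 2 * j}. of_int (sign p) * \<alpha> (\<lambda>i. v (p i)) *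
        ?B (\<lambda>i. v (p (2 + i)))) / fact 2 / 2 ^ j"
      by (subst wedge_alternation) (auto intro: loc)
    also have "\<dots> = (\<Sum>p | p permutes {..<2 * Suc j}.
        of_int (sign p) * (\<Prod>k<Suc j. \<alpha> (\<lambda>i. v (p (2 * k + i))))) / 2 ^ Suc j"
      by (simp add: prod.lessThan_Suc_shift mult.assoc del: prod.lessThan_Suc)
    finally show ?thesis .
  qed
  then show ?case by (rule ext)
qed

lemma wedge_one_form_power_eq_sum:
  assumes loc1: "\<And>v w. v 0 = w 0 \<Longrightarrow> \<mu> v = \<mu> w"
    and loc: "\<And>v w. v 0 = w 0 \<Longrightarrow> v 1 = w 1 \<Longrightarrow> \<alpha> v = \<alpha> w"
  shows "wedge 1 (2 * j) \<mu> (wedge_power \<alpha> j) v = (\<Sum>p | p permutes {..<2 * j + 1}.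
     of_int (sign p) * \<mu> (\<lambda>i. v (p i)) * (\<Prod>k<j. \<alpha> (\<lambda>i. v (p (2 * k + 1 + i))))) / 2 ^ j"
proof -
  let ?B = "\<lambda>v. \<Prod>k<j. \<alpha> (\<lambda>i. v (2 * k + i))"
  have "wedge 1 (2 * j) \<mu> (wedge_power \<alpha> j) v =
      wedge 1 (2 * j) \<mu> (\<lambda>v. \<Sum>q | q permutes {..<2 * j}. of_int (sign q) * ?B (\<lambda>i. v (q i))) v / 2 ^ j"
    by (simp only: wedge_power_eq_sum[of \<alpha>, OF loc] wedge_divide_right)
  also have "\<dots> = (\<Sum>p | p permutes {..<1 + 2 * j}. of_int (sign p) * \<mu> (\<lambda>i. v (p i)) *
      ?B (\<lambda>i. v (p (1 + i)))) / fact 1 / 2 ^ j"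
    by (subst wedge_alternation) (auto intro: loc1)
  finally show ?thesis by (simp add: add.commute add.left_commute)
qed

section \<open>Adding a plane to the index set\<close>

text \<open>
  Exchanging two consecutive pairs of positions is a product of two transpositions, hence even.
  This is the commutativity of 2-forms. Position 0 is kept for the argument of a 1-form.
\<close>

lemma pair_swap_perm:
  fixes k l m :: nat
  assumes "k \<le> m"
  defines "\<tau> \<equiv> Transposition.transpose (2*k+1) (2*m+1) \<circ> Transposition.transpose (2*k+2) (2*m+2)"
  shows "\<tau> permutes {..<2*m+3}" "sign \<tau> = 1" "\<tau> 0 = 0"
    "\<tau> (2*l+1) = 2 * Transposition.transpose k m l + 1" "\<tau> (2*l+2) = 2 * Transposition.transpose k m l + 2"
proof -
  show "\<tau> permutes {..<2*m+3}"
    unfolding \<tau>_def by (intro permutes_compose permutes_swap_id) (use assms in auto)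
  show "sign \<tau> = 1"
    unfolding \<tau>_def by (subst sign_compose) (auto simp: sign_swap_id permutation_swap_id)
  show "\<tau> 0 = 0" unfolding \<tau>_def by (simp add: Transposition.transpose_def)
  have par: "2 * x \<noteq> Suc (2 * y)" for x y :: nat by presburger
  show "\<tau> (2*l+1) = 2 * Transposition.transpose k m l + 1" "\<tau> (2*l+2) = 2 * Transposition.transpose k m l + 2"
    unfolding \<tau>_def Transposition.transpose_def using par par[symmetric] by simp_all
qed

text \<open>
  Here \<open>M\<close> and \<open>W\<close> are the coefficients of a 1-form and a 2-form in a basis whose last two vectors
  span a plane that is \<open>W\<close>-orthogonal to the others and on which \<open>M\<close> vanishes. In a nonzero
  term, the values \<open>a\<close> and \<open>a + 1\<close> must occupy the two positions of one pair. There are \<open>Suc m\<close> such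
  pairs, all contributing the same by \<open>pair_swap_perm\<close>. If it is the last pair, the permutation
  preserves \<open>{..<a}\<close>, and the two orders of \<open>a\<close> and \<open>a + 1\<close> both contribute the factor \<open>s\<close>, the sign
  of the transposition making up for that of \<open>W (a + 1) a\<close>.
\<close>

lemma sum_permutations_extra_pair:
  fixes M :: "nat \<Rightarrow> real" and W :: "nat \<Rightarrow> nat \<Rightarrow> real" and m :: nat
  defines "a \<equiv> 2 * m + 1"
  assumes M: "M a = 0" "M (a + 1) = 0"
    and W: "\<And>i j. i < a \<Longrightarrow> a \<le> j \<Longrightarrow> W i j = 0" "\<And>i j. a \<le> i \<Longrightarrow> j < a \<Longrightarrow> W i j = 0"
    and s: "W a (a + 1) = s" "W (a + 1) a = - s"
  shows "(\<Sum>p | p permutes {..<a + 2}.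
       of_int (sign p) * M (p 0) * (\<Prod>k<Suc m. W (p (2 * k + 1)) (p (2 * k + 2)))) =
     2 * real (Suc m) * s * (\<Sum>q | q permutes {..<a}.
       of_int (sign q) * M (q 0) * (\<Prod>k<m. W (q (2 * k + 1)) (q (2 * k + 2))))"
    (is "sum ?G ?P = _ * ?R")
proof -
  have finP: "finite ?P" by (rule finite_permutations) simp
  define T where "T k = {p. p permutes {..<a + 2} \<and> {p (2*k+1), p (2*k+2)} = {a, a + 1}}" for k
  \<comment> \<open>Moving the special pair to the end.\<close>
  have swap: "sum ?G (T k) = sum ?G (T m)" if k: "k \<le> m" for k
  proof -
    define \<tau> where "\<tau> = Transposition.transpose (2*k+1) (2*m+1) \<circ> Transposition.transpose (2*k+2) (2*m+2)"
    note \<tau> = pair_swap_perm[OF k, folded \<tau>_def]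
    have perm: "\<tau> permutes {..<a + 2}" using \<tau>(1) by (simp add: a_def numeral_3_eq_3)
    have inv: "\<tau> (\<tau> i) = i" for i
    proof -
      consider "i = 0" | l where "i = 2*l+1" | l where "i = 2*l+2"
      proof -
        have "i = 0 \<or> (\<exists>l. i = 2*l+1) \<or> (\<exists>l. i = 2*l+2)" by presburger
        then show thesis using that by blast
      qed
      then show ?thesis by cases (simp_all only: \<tau> transpose_involutory)
    qed
    have GT: "?G (p \<circ> \<tau>) = ?G p" if p: "p permutes {..<a + 2}" for p
    proof -
      have "sign (p \<circ> \<tau>) = sign p"
        using sign_compose[OF permutes_imp_permutation[OF _ p] permutes_imp_permutation[OF _ perm]]
          \<tau>(2) by simp
      moreover have "(\<Prod>l<Suc m. W ((p \<circ> \<tau>) (2 * l + 1)) ((p \<circ> \<tau>) (2 * l + 2))) =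
          (\<Prod>l<Suc m. W (p (2 * Transposition.transpose k m l + 1)) (p (2 * Transposition.transpose k m l + 2)))"
        by (simp only: comp_apply \<tau>)
      moreover have "\<dots> = (\<Prod>l<Suc m. W (p (2 * l + 1)) (p (2 * l + 2)))"
        by (rule prod.reindex_bij_betw[where g = "\<lambda>l. W (p (2 * l + 1)) (p (2 * l + 2))"])
          (rule permutes_imp_bij, rule permutes_swap_id, use k in auto)
      ultimately show ?thesis using \<tau>(3) by simp
    qed
    have mem: "p \<circ> \<tau> \<in> T m \<longleftrightarrow> p \<in> T k" if "p permutes {..<a + 2}" for p
      using permutes_compose[OF perm that] that \<tau>(4)[of m] \<tau>(5)[of m] by (simp add: T_def)
    have mem2: "p \<circ> \<tau> \<in> T k \<longleftrightarrow> p \<in> T m" if "p permutes {..<a + 2}" for p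
      using permutes_compose[OF perm that] that \<tau>(4)[of k] \<tau>(5)[of k] by (simp add: T_def)
    show ?thesis
      by (rule sum.reindex_bij_witness[where i = "\<lambda>p. p \<circ> \<tau>" and j = "\<lambda>p. p \<circ> \<tau>"])
        (use mem mem2 GT inv in \<open>auto simp: T_def fun_eq_iff\<close>)
  qed
  have last: "sum ?G (T m) = 2 * s * ?R"
  proof -
    have inj: "p permutes S \<Longrightarrow> p x = p y \<Longrightarrow> x = y" for p :: "nat \<Rightarrow> nat" and S x y
      using permutes_inj injD by metis
    have T_eq: "T m = {p. p permutes {..<a + 2} \<and> p ` {..<a} \<subseteq> {..<a}}" (is "_ = ?B")
    proof (intro set_eqI iffI)
      fix p assume "p \<in> T m"
      then have p: "p permutes {..<a + 2}" and ab: "{p a, p (a + 1)} = {a, a + 1}"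
        by (simp_all add: T_def a_def)
      have "p i < a" if "i < a" for i
      proof -
        have "p i < a + 2" using permutes_in_image[OF p, of i] that by simp
        moreover have "p i \<noteq> p a" "p i \<noteq> p (a + 1)" using inj[OF p, of i] that by auto
        then have "p i \<noteq> a" "p i \<noteq> a + 1" using ab by (auto simp: doubleton_eq_iff)
        ultimately show ?thesis by linarith
      qed
      then show "p \<in> ?B" using p by auto
    next
      fix p assume "p \<in> ?B"
      then have p: "p permutes {..<a + 2}" and low: "p ` {..<a} \<subseteq> {..<a}" by auto
      have img: "p ` {..<a} = {..<a}"
        by (rule endo_inj_surj[OF _ low permutes_inj_on[OF p]]) simp
      have "p i \<in> {a, a + 1}" if "i \<in> {a, a + 1}" for i
      proof -
        have "p i < a + 2" using permutes_in_image[OF p, of i] that by auto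
        moreover have "p i \<notin> p ` {..<a}" using inj[OF p] that by fastforce
        ultimately show ?thesis using img by auto
      qed
      from this[of a] this[of "a + 1"] inj[OF p, of a "a + 1"] have "{p a, p (a + 1)} = {a, a + 1}"
        by auto
      then show "p \<in> T m" using p by (simp add: T_def a_def)
    qed
    have "sum ?G (T m) = (\<Sum>q | q permutes {..<a}.
        ?G (q \<circ> shift_perm a 2 id) + ?G (q \<circ> shift_perm a 2 (Transposition.transpose 0 1)))"
      unfolding T_eq sum_block_permutations sum_permutations_2 ..
    also have "\<dots> = (\<Sum>q | q permutes {..<a}. 2 * s *
        (of_int (sign q) * M (q 0) * (\<Prod>k<m. W (q (2 * k + 1)) (q (2 * k + 2)))))"
    proof (rule sum.cong[OF refl])
      fix q assume "q \<in> {q. q permutes {..<a}}"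
      then have q: "q permutes {..<a}" by simp
      have *: "?G (q \<circ> shift_perm a 2 r) = of_int (sign r) * W (a + r 0) (a + r 1) *
          (of_int (sign q) * M (q 0) * (\<Prod>k<m. W (q (2 * k + 1)) (q (2 * k + 2))))"
        if r: "r permutes {..<2}" for r
      proof -
        have "(\<Prod>k<m. W ((q \<circ> shift_perm a 2 r) (2 * k + 1)) ((q \<circ> shift_perm a 2 r) (2 * k + 2)))
           = (\<Prod>k<m. W (q (2 * k + 1)) (q (2 * k + 2)))"
          by (rule prod.cong[OF refl], subst (1 2) block_perm_low[OF q r]) (auto simp: a_def)
        moreover have "(q \<circ> shift_perm a 2 r) (2 * m + 1) = a + r 0"
          "(q \<circ> shift_perm a 2 r) (2 * m + 2) = a + r 1"
          using block_perm_high[OF q r, of 0] block_perm_high[OF q r, of 1] by (simp_all add: a_def)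
        moreover have "(q \<circ> shift_perm a 2 r) 0 = q 0"
          by (rule block_perm_low[OF q r]) (simp add: a_def)
        ultimately show ?thesis
          unfolding prod.lessThan_Suc sign_block_perm[OF q r] by (simp add: mult_ac)
      qed
      have r: "id permutes {..<2::nat}" "Transposition.transpose 0 1 permutes {..<2::nat}"
        using permutes_lessThan_2 by auto
      show "?G (q \<circ> shift_perm a 2 id) + ?G (q \<circ> shift_perm a 2 (Transposition.transpose 0 1)) = 2 * s *
        (of_int (sign q) * M (q 0) * (\<Prod>k<m. W (q (2 * k + 1)) (q (2 * k + 2))))"
        unfolding *[OF r(1)] *[OF r(2)] using s by (simp add: sign_swap_id)
    qed
    finally show ?thesis by (simp add: sum_distrib_left)
  qed
  \<comment> \<open>A nonzero term lies in exactly one \<open>T k\<close>, the pair that contains the preimage of \<open>a\<close>.\<close>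
  have split: "?G p = (\<Sum>k<Suc m. if p \<in> T k then ?G p else 0)" if p: "p permutes {..<a + 2}" for p
  proof (cases "?G p = 0")
    case True
    show ?thesis by (simp only: True if_cancel sum.neutral_const)
  next
    case False
    have bnd: "i < a + 2 \<Longrightarrow> p i < a + 2" for i using permutes_in_image[OF p, of i] by simp
    obtain i where i: "p i = a" "i < a + 2"
      using permutes_surj[OF p] permutes_in_image[OF p] by (metis lessThan_iff less_add_same_cancel1 pos2 surjD)
    have inj: "p x = p y \<Longrightarrow> x = y" for x y using permutes_inj[OF p] injD by metis
    have Wne: "W (p (2 * k + 1)) (p (2 * k + 2)) \<noteq> 0" if "k < Suc m" for k
      using False that by (auto simp del: prod.lessThan_Suc)
    have "i \<noteq> 0"
    proof
      assume "i = 0"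
      then have "M (p 0) = 0" using i M by simp
      with False show False by simp
    qed
    then have "\<exists>k<Suc m. i = 2 * k + 1 \<or> i = 2 * k + 2"
      using i(2) unfolding a_def by presburger
    then obtain k where k: "k < Suc m" "i = 2 * k + 1 \<or> i = 2 * k + 2"
      by blast
    have "p \<in> T k"
    proof -
      have b: "p (2*k+1) < a + 2" "p (2*k+2) < a + 2"
        using bnd[of "2*k+1"] bnd[of "2*k+2"] k(1) unfolding a_def by simp_all
      have ne: "p (2*k+1) \<noteq> p (2*k+2)" using inj by force
      show ?thesis using k(2)
      proof
        assume "i = 2 * k + 1"
        then have "\<not> p (2*k+2) < a" using W(2)[of a "p (2*k+2)"] Wne[OF k(1)] i by auto
        then have "p (2*k+2) = a + 1" using b ne i \<open>i = 2 * k + 1\<close> by auto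
        then show ?thesis using p i \<open>i = 2 * k + 1\<close> by (auto simp: T_def)
      next
        assume "i = 2 * k + 2"
        then have "\<not> p (2*k+1) < a" using W(1)[of "p (2*k+1)" a] Wne[OF k(1)] i by auto
        then have "p (2*k+1) = a + 1" using b ne i \<open>i = 2 * k + 2\<close> by auto
        then show ?thesis using p i \<open>i = 2 * k + 2\<close> by (auto simp: T_def)
      qed
    qed
    moreover have "p \<in> T k' \<Longrightarrow> k' = k" for k'
    proof -
      assume "p \<in> T k'"
      then have "p i \<in> {p (2*k'+1), p (2*k'+2)}" using i by (simp add: T_def)
      then have "i = 2*k'+1 \<or> i = 2*k'+2" using inj by auto
      then show "k' = k" using k(2) by presburger
    qed
    ultimately have iff: "p \<in> T k' \<longleftrightarrow> k' = k" for k' by blast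
    show ?thesis
      using k(1) by (simp only: iff sum.delta finite_lessThan lessThan_iff if_True)
  qed
  have "sum ?G ?P = (\<Sum>p\<in>?P. \<Sum>k<Suc m. if p \<in> T k then ?G p else 0)"
    by (rule sum.cong[OF refl]) (use split in blast)
  also have "\<dots> = (\<Sum>k<Suc m. \<Sum>p\<in>?P. if p \<in> T k then ?G p else 0)"
    by (rule sum.swap)
  also have "\<dots> = (\<Sum>k<Suc m. sum ?G (T m))"
  proof (rule sum.cong[OF refl])
    fix k assume k: "k \<in> {..<Suc m}"
    have "?P \<inter> T k = T k" by (auto simp: T_def)
    then have "(\<Sum>p\<in>?P. if p \<in> T k then ?G p else 0) = sum ?G (T k)"
      using sum.inter_restrict[OF finP, of ?G "T k"] by simp
    then show "(\<Sum>p\<in>?P. if p \<in> T k then ?G p else 0) = sum ?G (T m)" using swap[of k] k by simp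
  qed
  also have "\<dots> = 2 * real (Suc m) * s * ?R" by (simp only: last sum_constant) simp
  finally show ?thesis .
qed

section \<open>Maps of class \<open>C\<^sup>k\<close>\<close>

lemma Ck_on_cong:
  assumes "open S" "\<And>x. x \<in> S \<Longrightarrow> f x = g x" "Ck_on k S f"
  shows "Ck_on k S g"
  using assms(2,3)
proof (induction k arbitrary: f g)
  case 0
  then show ?case using continuous_on_cong[of S S f g] by simp
next
  case (Suc k)
  have "(g has_derivative frechet_derivative f (at x)) (at x)" if "x \<in> S" for x
  proof (rule has_derivative_transform_within_open[OF _ assms(1) that])
    show "(f has_derivative frechet_derivative f (at x)) (at x)"
      using Suc.prems(2) that frechet_derivative_works by auto
  qed (use Suc.prems in auto)
  then have g: "g differentiable at x" "frechet_derivative f (at x) = frechet_derivative g (at x)" if "x \<in> S" for x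
    using that by (auto simp: differentiable_def intro: frechet_derivative_at)
  have "Ck_on k S (\<lambda>x. frechet_derivative g (at x) v)" for v
    by (rule Suc.IH[of "\<lambda>x. frechet_derivative f (at x) v"]) (use Suc.prems g in auto)
  then show ?case using g by auto
qed

text \<open>
  The usual way to verify differentiability to all orders: an explicit derivative replaces
  the chosen one, by congruence on the open set.
\<close>

lemma Ck_on_SucI:
  assumes "open S" "\<And>x. x \<in> S \<Longrightarrow> (f has_derivative F x) (at x)"
    and "\<And>v. Ck_on k S (\<lambda>x. F x v)"
  shows "Ck_on (Suc k) S f"
proof -
  have "Ck_on k S (\<lambda>x. frechet_derivative f (at x) v)" for v
    by (rule Ck_on_cong[OF assms(1) _ assms(3)[of v]])
      (use frechet_derivative_at[OF assms(2)] in auto)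
  then show ?thesis using assms(2) by (auto simp: differentiable_def)
qed

lemma Ck_on_Suc_has_derivative:
  "Ck_on (Suc k) S f \<Longrightarrow> x \<in> S \<Longrightarrow> (f has_derivative frechet_derivative f (at x)) (at x)"
  using frechet_derivative_works by auto

lemma Ck_on_Suc_imp: "Ck_on (Suc k) S f \<Longrightarrow> Ck_on k S f"
proof (induction k arbitrary: f)
  case 0
  then show ?case
    by (auto intro!: continuous_at_imp_continuous_on differentiable_imp_continuous_within)
next
  case (Suc k)
  then have "Ck_on (Suc k) S (\<lambda>x. frechet_derivative f (at x) v)" for v
    using Ck_on.simps(2)[of "Suc k" S f] by blast
  with Suc.IH have "Ck_on k S (\<lambda>x. frechet_derivative f (at x) v)" for v .
  then show ?case using Suc.prems Ck_on.simps(2) by metis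
qed

lemma Ck_on_const: "Ck_on k S (\<lambda>x. c)"
proof (induction k arbitrary: c)
  case (Suc k)
  then show ?case by (simp add: frechet_derivative_const)
qed auto

lemma Ck_on_bounded_linear:
  assumes "bounded_linear L" "open S"
  shows "Ck_on k S L"
proof (cases k)
  case 0
  then show ?thesis using linear_continuous_on[OF assms(1)] by simp
next
  case (Suc l)
  show ?thesis unfolding Suc
    by (rule Ck_on_SucI[OF assms(2) bounded_linear_imp_has_derivative[OF assms(1)] Ck_on_const])
qed

lemma Ck_on_compose_affine:
  assumes L: "bounded_linear L" and "open S" and sub: "\<And>x. x \<in> S \<Longrightarrow> L x + c \<in> T" and f: "Ck_on k T f"
  shows "Ck_on k S (\<lambda>x. f (L x + c))"
  using f
proof (induction k arbitrary: f)
  case 0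
  have "continuous_on S (\<lambda>x. L x + c)"
    by (intro continuous_intros linear_continuous_on L)
  then show ?case
    using 0 sub continuous_on_compose2[of T f S "\<lambda>x. L x + c"] by auto
next
  case (Suc k)
  show ?case
  proof (rule Ck_on_SucI[OF \<open>open S\<close>])
    fix x assume "x \<in> S"
    have "((\<lambda>x. L x + c) has_derivative L) (at x)"
      using has_derivative_add[OF bounded_linear_imp_has_derivative[OF L] has_derivative_const] by simp
    from has_derivative_compose[OF this Ck_on_Suc_has_derivative[OF Suc.prems sub[OF \<open>x \<in> S\<close>]]]
    show "((\<lambda>x. f (L x + c)) has_derivative (\<lambda>v. frechet_derivative f (at (L x + c)) (L v))) (at x)"
      by simp
  next
    fix v show "Ck_on k S (\<lambda>x. frechet_derivative f (at (L x + c)) (L v))"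
      using Suc.IH[of "\<lambda>y. frechet_derivative f (at y) (L v)"] Suc.prems by simp
  qed
qed

lemma Ck_on_linear_image:
  assumes L: "bounded_linear L" and "open S" and f: "Ck_on k S f"
  shows "Ck_on k S (\<lambda>x. L (f x))"
  using f
proof (induction k arbitrary: f)
  case 0
  then show ?case using bounded_linear.continuous_on[OF L] by auto
next
  case (Suc k)
  show ?case
    by (rule Ck_on_SucI[OF \<open>open S\<close> bounded_linear.has_derivative[OF L Ck_on_Suc_has_derivative[OF Suc.prems]]])
      (use Suc in auto)
qed

lemma Ck_on_add:
  assumes "open S" "Ck_on k S f" "Ck_on k S g"
  shows "Ck_on k S (\<lambda>x. f x + g x)"
  using assms(2,3)
proof (induction k arbitrary: f g)
  case 0
  then show ?case by (auto intro: continuous_on_add)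
next
  case (Suc k)
  show ?case
    by (rule Ck_on_SucI[OF \<open>open S\<close> has_derivative_add[OF Ck_on_Suc_has_derivative Ck_on_Suc_has_derivative]])
      (use Suc in auto)
qed

text \<open>
  The product rule involves the factors themselves besides their derivatives, so the induction needs
  that class \<open>C\<^sup>k\<^sup>+\<^sup>1\<close> implies class \<open>C\<^sup>k\<close>.
\<close>

lemma (in bounded_bilinear) Ck_on:
  assumes "open S" "Ck_on k S f" "Ck_on k S g"
  shows "Ck_on k S (\<lambda>x. prod (f x) (g x))"
  using assms(2,3)
proof (induction k arbitrary: f g)
  case 0
  then show ?case by (auto intro: continuous_on)
next
  case (Suc k)
  show ?case
  proof (rule Ck_on_SucI[OF \<open>open S\<close> FDERIV[OF Ck_on_Suc_has_derivative[OF Suc.prems(1)] Ck_on_Suc_has_derivative[OF Suc.prems(2)]]])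
    show "Ck_on k S (\<lambda>x. prod (f x) (frechet_derivative g (at x) v) + prod (frechet_derivative f (at x) v) (g x))" for v
      by (rule Ck_on_add[OF \<open>open S\<close>]; rule Suc.IH)
        (use Suc.prems Ck_on_Suc_imp[OF Suc.prems(1)] Ck_on_Suc_imp[OF Suc.prems(2)] in auto)
  qed
qed

text \<open>
  The derivative of \<open>1 / f\<close> is a polynomial in \<open>f'\<close> and \<open>1 / f\<close>, so the induction feeds on itself.
  Complex values are needed for the transition map of the sphere, real ones for its area form.
\<close>

lemma Ck_on_inverse:
  fixes f :: "'a::euclidean_space \<Rightarrow> 'b::real_normed_field"
  assumes "open S" "Ck_on k S f" "\<And>x. x \<in> S \<Longrightarrow> f x \<noteq> 0"
  shows "Ck_on k S (\<lambda>x. inverse (f x))"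
  using assms(2)
proof (induction k)
  case 0
  then show ?case using assms(3) by (auto intro: continuous_on_inverse)
next
  case (Suc k)
  have IH: "Ck_on k S (\<lambda>x. inverse (f x))" by (rule Suc.IH[OF Ck_on_Suc_imp[OF Suc.prems]])
  show ?case
  proof (rule Ck_on_SucI[OF \<open>open S\<close> Deriv.has_derivative_inverse[OF assms(3) Ck_on_Suc_has_derivative[OF Suc.prems]]])
    fix v
    show "Ck_on k S (\<lambda>x. - (inverse (f x) * frechet_derivative f (at x) v * inverse (f x)))"
      using Suc.prems by (intro Ck_on_linear_image[OF bounded_linear_minus[OF bounded_linear_ident] \<open>open S\<close>]
        bounded_bilinear.Ck_on[OF bounded_bilinear_mult \<open>open S\<close>] IH) auto
  qed
qed

lemma Ck_on_Pair:
  assumes "open S" "Ck_on k S f" "Ck_on k S g"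
  shows "Ck_on k S (\<lambda>x. (f x, g x))"
proof -
  have "Ck_on k S (\<lambda>x. (f x, 0) + (0, g x))"
    by (intro Ck_on_add Ck_on_linear_image[where L = "\<lambda>x. (x, 0)"] Ck_on_linear_image[where L = "\<lambda>x. (0, x)"]
        bounded_linear_Pair bounded_linear_ident bounded_linear_zero assms)
  then show ?thesis by simp
qed

lemma smooth_on_has_derivative:
  "smooth_on S f \<Longrightarrow> x \<in> S \<Longrightarrow> (f has_derivative frechet_derivative f (at x)) (at x)"
  unfolding smooth_on_def using Ck_on_Suc_has_derivative by blast

lemma smooth_on_cong:
  "open S \<Longrightarrow> (\<And>x. x \<in> S \<Longrightarrow> f x = g x) \<Longrightarrow> smooth_on S f \<Longrightarrow> smooth_on S g"
  unfolding smooth_on_def using Ck_on_cong by blast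

lemma smooth_on_map_prod:
  assumes "open S" "open T" "smooth_on S f" "smooth_on T g"
  shows "smooth_on (S \<times> T) (map_prod f g)"
  unfolding smooth_on_def
proof
  fix k
  have "Ck_on k (S \<times> T) (\<lambda>x. (f (fst x + 0), g (snd x + 0)))"
    by (intro Ck_on_Pair Ck_on_compose_affine[where T = S] Ck_on_compose_affine[where T = T]
        bounded_linear_fst bounded_linear_snd open_Times)
      (use assms in \<open>auto simp: smooth_on_def\<close>)
  moreover have "map_prod f g = (\<lambda>x. (f (fst x + 0), g (snd x + 0)))" by auto
  ultimately show "Ck_on k (S \<times> T) (map_prod f g)" by simp
qed

section \<open>Charts and their products\<close>

lemma oriented_manifoldD:
  assumes "oriented_manifold (M :: ('a, 'e::euclidean_space) manifold)"
  shows "Hausdorff_space (mtop M)" "second_countable (mtop M)"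
    "bij_betw (frame M) {..<DIM('e)} Basis" "(\<Union>c\<in>charts M. fst c) = topspace (mtop M)"
    and "\<And>c. c \<in> charts M \<Longrightarrow> openin (mtop M) (fst c)"
    and "\<And>c. c \<in> charts M \<Longrightarrow> open (coord_range c)"
    and "\<And>c. c \<in> charts M \<Longrightarrow>
      homeomorphic_map (subtopology (mtop M) (fst c)) (top_of_set (coord_range c)) (snd c)"
    and "\<And>c d. c \<in> charts M \<Longrightarrow> d \<in> charts M \<Longrightarrow> smooth_on (snd c ` (fst c \<inter> fst d)) (transition c d)"
    and "\<And>c d x. c \<in> charts M \<Longrightarrow> d \<in> charts M \<Longrightarrow> x \<in> snd c ` (fst c \<inter> fst d) \<Longrightarrow>
      frame_det (frame M) (\<lambda>i. frechet_derivative (transition c d) (at x) (frame M i)) > 0"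
  using assms unfolding oriented_manifold_def by blast+

lemma chart_inj_on:
  assumes "oriented_manifold M" "c \<in> charts M"
  shows "inj_on (snd c) (fst c)"
proof -
  have "topspace (subtopology (mtop M) (fst c)) = fst c"
    using openin_subset[OF oriented_manifoldD(5)[OF assms]] by auto
  then show ?thesis
    using homeomorphic_imp_injective_map[OF oriented_manifoldD(7)[OF assms]] by simp
qed

lemma open_overlap:
  assumes M: "oriented_manifold M" and c: "c \<in> charts M" and d: "d \<in> charts M"
  shows "open (snd c ` (fst c \<inter> fst d))"
proof -
  have "openin (subtopology (mtop M) (fst c)) (fst c \<inter> fst d)"
    using oriented_manifoldD(5)[OF M d] by (simp add: openin_subtopology_Int2 Int_commute)
  then have "openin (top_of_set (coord_range c)) (snd c ` (fst c \<inter> fst d))"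
    using homeomorphic_map_openness_eq[OF oriented_manifoldD(7)[OF M c]] by blast
  then show ?thesis
    using oriented_manifoldD(6)[OF M c] openin_open_trans by blast
qed

lemma transition_apply:
  assumes "inj_on (snd c) (fst c)" "p \<in> fst c"
  shows "transition c d (snd c p) = snd d p"
  using assms by (simp add: transition_def)

lemma transition_has_derivative:
  assumes "oriented_manifold M" "c \<in> charts M" "d \<in> charts M" "p \<in> fst c \<inter> fst d"
  shows "(transition c d has_derivative frechet_derivative (transition c d) (at (snd c p))) (at (snd c p))"
  by (rule smooth_on_has_derivative[OF oriented_manifoldD(8)[OF assms(1-3)]]) (use assms(4) in blast)

lemma fst_prod_chart [simp]: "fst (prod_chart c d) = fst c \<times> fst d"
  and snd_prod_chart [simp]: "snd (prod_chart c d) = map_prod (snd c) (snd d)"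
  by (simp_all add: prod_chart_def)

lemma coord_range_prod_chart: "coord_range (prod_chart c d) = coord_range c \<times> coord_range d"
  by (auto simp: coord_range_def map_prod_def image_iff)

lemma prod_chart_overlap:
  "snd (prod_chart c c') ` (fst (prod_chart c c') \<inter> fst (prod_chart d d')) =
     (snd c ` (fst c \<inter> fst d)) \<times> (snd c' ` (fst c' \<inter> fst d'))"
  by (force simp: image_iff)

lemma transition_prod_chart:
  assumes "inj_on (snd c) (fst c)" "inj_on (snd c') (fst c')" "x \<in> coord_range c" "y \<in> coord_range c'"
  shows "transition (prod_chart c c') (prod_chart d d') (x, y) = (transition c d x, transition c' d' y)"
proof -
  obtain p q where pq: "p \<in> fst c" "x = snd c p" "q \<in> fst c'" "y = snd c' q"
    using assms by (auto simp: coord_range_def)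
  have inj: "inj_on (snd (prod_chart c c')) (fst (prod_chart c c'))"
    using map_prod_inj_on[OF assms(1,2)] by simp
  show ?thesis
    using transition_apply[OF inj, of "(p, q)" "prod_chart d d'"] pq
      transition_apply[OF assms(1), of p d] transition_apply[OF assms(2), of q d'] by simp
qed

text \<open>
  The inverse of a product chart is the product of the inverses only on the coordinate range, where
  the points have preimages; the range being open, this suffices for derivatives.
\<close>

lemma transition_prod_chart_has_derivative:
  assumes inj: "inj_on (snd c) (fst c)" "inj_on (snd c') (fst c')"
    and "open (coord_range c)" "open (coord_range c')"
    and "x \<in> coord_range c" "y \<in> coord_range c'"
    and f: "(transition c d has_derivative f) (at x)"
    and g: "(transition c' d' has_derivative g) (at y)"
  shows "(transition (prod_chart c c') (prod_chart d d') has_derivative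
     (\<lambda>h. (f (fst h), g (snd h)))) (at (x, y))"
proof (rule has_derivative_transform_within_open)
  show "((\<lambda>z. (transition c d (fst z), transition c' d' (snd z))) has_derivative
     (\<lambda>h. (f (fst h), g (snd h)))) (at (x, y))"
    using f g
    by (intro has_derivative_Pair has_derivative_compose[OF has_derivative_fst[OF has_derivative_ident]]
        has_derivative_compose[OF has_derivative_snd[OF has_derivative_ident]]) auto
  show "open (coord_range c \<times> coord_range c')"
    by (intro open_Times assms)
  show "(x, y) \<in> coord_range c \<times> coord_range c'"
    using assms by blast
  show "z \<in> coord_range c \<times> coord_range c' \<Longrightarrow>
    (transition c d (fst z), transition c' d' (snd z)) =
    transition (prod_chart c c') (prod_chart d d') z" for z
    using transition_prod_chart[OF inj, where d = d and d' = d'] by auto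
qed

lemma frechet_derivative_transition_prod_chart:
  assumes M: "oriented_manifold M" "c \<in> charts M" "d \<in> charts M" "p \<in> fst c \<inter> fst d"
    and N: "oriented_manifold N" "c' \<in> charts N" "d' \<in> charts N" "q \<in> fst c' \<inter> fst d'"
  shows "frechet_derivative (transition (prod_chart c c') (prod_chart d d')) (at (snd c p, snd c' q)) =
     (\<lambda>h. (frechet_derivative (transition c d) (at (snd c p)) (fst h),
           frechet_derivative (transition c' d') (at (snd c' q)) (snd h)))"
  by (rule frechet_derivative_at[symmetric], rule transition_prod_chart_has_derivative)
    (use M N in \<open>auto simp: coord_range_def intro: chart_inj_on transition_has_derivative
      oriented_manifoldD(6)[unfolded coord_range_def]\<close>)

section \<open>Products of oriented manifolds\<close>

lemma charts_prod_manifold: "charts (M \<times>\<^sub>M N) = {prod_chart c d |c d. c \<in> charts M \<and> d \<in> charts N}"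
  by (simp add: prod_manifold_def)

lemma frame_prod_manifold:
  fixes M :: "('a, 'e::euclidean_space) manifold" and N :: "('b, 'f::euclidean_space) manifold"
  shows "frame (M \<times>\<^sub>M N) = (\<lambda>i. if i < DIM('e) then (frame M i, 0) else (0, frame N (i - DIM('e))))"
  by (simp add: prod_manifold_def)

lemma prod_lessThan_add:
  fixes f :: "nat \<Rightarrow> 'b::comm_monoid_mult"
  shows "prod f {..<a + b} = prod f {..<a} * (\<Prod>i<b. f (a + i))"
  by (induction b) (auto simp: mult.assoc)

text \<open>
  The matrix is block diagonal, so only permutations preserving the first block contribute to the
  determinant.
\<close>

lemma frame_det_prod:
  fixes b1 v1 :: "nat \<Rightarrow> 'e::euclidean_space" and b2 v2 :: "nat \<Rightarrow> 'f::euclidean_space"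
  defines "a \<equiv> DIM('e)"
  shows "frame_det (\<lambda>i. if i < a then (b1 i, 0) else (0, b2 (i - a)))
     (\<lambda>i. if i < a then (v1 i, 0) else (0, v2 (i - a))) = frame_det b1 v1 * frame_det b2 v2"
proof -
  let ?b = "\<lambda>i. if i < a then (b1 i, 0) else (0, b2 (i - a))"
  let ?v = "\<lambda>i. if i < a then (v1 i, 0) else (0, v2 (i - a))"
  let ?d = "DIM('f)"
  let ?g = "\<lambda>p. of_int (sign p) * (\<Prod>i<a + ?d. ?v i \<bullet> ?b (p i)) :: real"
  let ?P = "{p. p permutes {..<a + ?d}}"
  have fin: "finite ?P" by (rule finite_permutations) simp
  have "frame_det ?b ?v = sum ?g ?P" by (simp add: frame_det_def a_def)
  also have "\<dots> = sum ?g {p. p permutes {..<a + ?d} \<and> p ` {..<a} \<subseteq> {..<a}}"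
  proof (rule sum.mono_neutral_right[OF fin])
    show "\<forall>p\<in>?P - {p. p permutes {..<a + ?d} \<and> p ` {..<a} \<subseteq> {..<a}}. ?g p = 0"
    proof
      fix p assume "p \<in> ?P - {p. p permutes {..<a + ?d} \<and> p ` {..<a} \<subseteq> {..<a}}"
      then obtain i where "i < a" "\<not> p i < a" by auto
      then have "(\<Prod>i<a + ?d. ?v i \<bullet> ?b (p i)) = 0" by (intro prod_zero bexI[of _ i]) auto
      then show "?g p = 0" by simp
    qed
  qed auto
  also have "\<dots> = (\<Sum>q | q permutes {..<a}. \<Sum>r | r permutes {..<?d}.
      (of_int (sign q) * (\<Prod>i<a. v1 i \<bullet> b1 (q i))) * (of_int (sign r) * (\<Prod>i<?d. v2 i \<bullet> b2 (r i))))"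
    unfolding sum_block_permutations
  proof (intro sum.cong refl)
    fix q r assume "q \<in> {q. q permutes {..<a}}" "r \<in> {r. r permutes {..<?d}}"
    then have q: "q permutes {..<a}" and r: "r permutes {..<?d}" by auto
    have "q i < a" if "i < a" for i using permutes_in_image[OF q, of i] that by simp
    then have "(\<Prod>i<a + ?d. ?v i \<bullet> ?b ((q \<circ> shift_perm a ?d r) i)) =
        (\<Prod>i<a. v1 i \<bullet> b1 (q i)) * (\<Prod>i<?d. v2 i \<bullet> b2 (r i))"
      unfolding prod_lessThan_add
      by (intro arg_cong2[where f = "(*)"] prod.cong refl)
        (simp_all only: block_perm_low[OF q r] block_perm_high[OF q r] lessThan_iff, simp_all)
    then show "?g (q \<circ> shift_perm a ?d r) =
       (of_int (sign q) * (\<Prod>i<a. v1 i \<bullet> b1 (q i))) * (of_int (sign r) * (\<Prod>i<?d. v2 i \<bullet> b2 (r i)))"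
      by (simp add: sign_block_perm[OF q r])
  qed
  also have "\<dots> = frame_det b1 v1 * frame_det b2 v2"
    unfolding frame_det_def a_def sum_product by simp
  finally show ?thesis .
qed

lemma second_countable_prod_topology:
  assumes "second_countable X" "second_countable Y"
  shows "second_countable (prod_topology X Y)"
proof -
  obtain B where B: "countable B" "\<And>V. V \<in> B \<Longrightarrow> openin X V"
    "\<And>U x. openin X U \<and> x \<in> U \<longrightarrow> (\<exists>V \<in> B. x \<in> V \<and> V \<subseteq> U)"
    using assms(1) by (auto simp: second_countable_def)
  obtain C where C: "countable C" "\<And>V. V \<in> C \<Longrightarrow> openin Y V"
    "\<And>U x. openin Y U \<and> x \<in> U \<longrightarrow> (\<exists>V \<in> C. x \<in> V \<and> V \<subseteq> U)"
    using assms(2) by (auto simp: second_countable_def)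
  show ?thesis unfolding second_countable_def
  proof (intro exI[of _ "(\<lambda>(V, W). V \<times> W) ` (B \<times> C)"] conjI)
    show "countable ((\<lambda>(V, W). V \<times> W) ` (B \<times> C))" by (intro countable_image countable_SIGMA B(1) C(1))
    show "\<forall>V\<in>(\<lambda>(V, W). V \<times> W) ` (B \<times> C). openin (prod_topology X Y) V"
      using B(2) C(2) by (auto simp: openin_prod_Times_iff)
    show "\<forall>U x. openin (prod_topology X Y) U \<and> x \<in> U \<longrightarrow> (\<exists>V\<in>(\<lambda>(V, W). V \<times> W) ` (B \<times> C). x \<in> V \<and> V \<subseteq> U)"
    proof (intro allI impI)
      fix U x assume Ux: "openin (prod_topology X Y) U \<and> x \<in> U"
      obtain x1 x2 where x: "x = (x1, x2)" by (cases x)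
      obtain U1 U2 where U: "openin X U1" "openin Y U2" "x1 \<in> U1" "x2 \<in> U2" "U1 \<times> U2 \<subseteq> U"
        using Ux unfolding openin_prod_topology_alt x by (elim conjE allE impE) blast+
      obtain V where V: "V \<in> B" "x1 \<in> V" "V \<subseteq> U1" using B(3)[of U1 x1] U(1,3) by blast
      obtain W where W: "W \<in> C" "x2 \<in> W" "W \<subseteq> U2" using C(3)[of U2 x2] U(2,4) by blast
      have "V \<times> W \<subseteq> U" using V W U(5) by blast
      then show "\<exists>V\<in>(\<lambda>(V, W). V \<times> W) ` (B \<times> C). x \<in> V \<and> V \<subseteq> U"
        using V W x by (intro bexI[of _ "V \<times> W"]) auto
    qed
  qed
qed

lemma homeomorphic_map_map_prod:
  assumes "homeomorphic_map X X' f" "homeomorphic_map Y Y' g"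
  shows "homeomorphic_map (prod_topology X Y) (prod_topology X' Y') (map_prod f g)"
proof -
  obtain f' g' where "homeomorphic_maps X X' f f'" "homeomorphic_maps Y Y' g g'"
    using assms homeomorphic_map_maps by metis
  then have "homeomorphic_maps (prod_topology X Y) (prod_topology X' Y') (\<lambda>(x,y). (f x, g y)) (\<lambda>(x,y). (f' x, g' y))"
    using homeomorphic_maps_prod by blast
  then show ?thesis
    unfolding map_prod_def by (rule homeomorphic_maps_imp_map)
qed

lemma oriented_manifold_prod:
  fixes M :: "('a, 'e::euclidean_space) manifold" and N :: "('b, 'f::euclidean_space) manifold"
  assumes M: "oriented_manifold M" and N: "oriented_manifold N"
  shows "oriented_manifold (M \<times>\<^sub>M N)"
proof -
  let ?P = "M \<times>\<^sub>M N"
  let ?a = "DIM('e)" and ?b = "DIM('f)"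
  have top: "mtop ?P = prod_topology (mtop M) (mtop N)"
    by (simp add: prod_manifold_def)
  note charts = charts_prod_manifold[of M N] and frame = frame_prod_manifold[of M N]
  have "bij_betw (frame ?P) ({..<?a} \<union> {?a..<?a + ?b}) ((\<lambda>u. (u, 0)) ` Basis \<union> (\<lambda>v. (0, v)) ` Basis)"
  proof (rule bij_betw_combine)
    have "bij_betw ((\<lambda>u. (u, 0)) \<circ> frame M) {..<?a} ((\<lambda>u. (u, 0::'f)) ` Basis)"
      by (rule bij_betw_trans[OF oriented_manifoldD(3)[OF M]]) (auto simp: bij_betw_def inj_on_def)
    then show "bij_betw (frame ?P) {..<?a} ((\<lambda>u. (u, 0)) ` Basis)"
      by (rule bij_betw_cong[THEN iffD1, rotated]) (simp add: frame)
    have "bij_betw ((\<lambda>v. (0, v)) \<circ> frame N \<circ> (\<lambda>i. i - ?a)) {?a..<?a + ?b} ((\<lambda>v. (0::'e, v)) ` Basis)"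
    proof (intro bij_betw_trans)
      show "bij_betw (\<lambda>i. i - ?a) {?a..<?a + ?b} {..<?b}"
        by (rule bij_betwI[where g = "(+) ?a"]) auto
      show "bij_betw (frame N) {..<?b} Basis" by (rule oriented_manifoldD(3)[OF N])
    qed (auto simp: bij_betw_def inj_on_def)
    then show "bij_betw (frame ?P) {?a..<?a + ?b} ((\<lambda>v. (0, v)) ` Basis)"
      by (rule bij_betw_cong[THEN iffD1, rotated]) (simp add: frame)
    show "(\<lambda>u. (u, 0)) ` Basis \<inter> (\<lambda>v. (0, v)) ` Basis = ({} :: ('e \<times> 'f) set)"
      by (auto simp: nonzero_Basis)
  qed
  moreover have "{..<?a} \<union> {?a..<?a + ?b} = {..<DIM('e \<times> 'f)}" by auto
  ultimately have bij: "bij_betw (frame ?P) {..<DIM('e \<times> 'f)} Basis"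
    unfolding Basis_prod_def by simp
  have chart: "openin (mtop ?P) (fst C) \<and> open (coord_range C) \<and>
        homeomorphic_map (subtopology (mtop ?P) (fst C)) (top_of_set (coord_range C)) (snd C)"
    if C: "C \<in> charts ?P" for C
  proof -
    obtain c d where cd: "C = prod_chart c d" "c \<in> charts M" "d \<in> charts N" using C charts by auto
    show ?thesis
      unfolding cd(1) top fst_prod_chart snd_prod_chart coord_range_prod_chart
      using oriented_manifoldD(5,6)[OF M cd(2)] oriented_manifoldD(5,6)[OF N cd(3)]
        homeomorphic_map_map_prod[OF oriented_manifoldD(7)[OF M cd(2)] oriented_manifoldD(7)[OF N cd(3)]]
      by (simp add: openin_prod_Times_iff open_Times subtopology_Times)
  qed
  have trans: "smooth_on (snd C ` (fst C \<inter> fst D)) (transition C D) \<and>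
        (\<forall>x\<in>snd C ` (fst C \<inter> fst D).
           frame_det (frame ?P) (\<lambda>i. frechet_derivative (transition C D) (at x) (frame ?P i)) > 0)"
    if C: "C \<in> charts ?P" and D: "D \<in> charts ?P" for C D
  proof -
    obtain c c' where cc: "C = prod_chart c c'" "c \<in> charts M" "c' \<in> charts N" using C charts by auto
    obtain d d' where dd: "D = prod_chart d d'" "d \<in> charts M" "d' \<in> charts N" using D charts by auto
    have "smooth_on ((snd c ` (fst c \<inter> fst d)) \<times> (snd c' ` (fst c' \<inter> fst d'))) (transition C D)"
    proof (rule smooth_on_cong)
      show "smooth_on ((snd c ` (fst c \<inter> fst d)) \<times> (snd c' ` (fst c' \<inter> fst d')))
          (map_prod (transition c d) (transition c' d'))"
        by (intro smooth_on_map_prod open_overlap[OF M] open_overlap[OF N] oriented_manifoldD(8)[OF M]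
            oriented_manifoldD(8)[OF N] cc dd)
      show "open ((snd c ` (fst c \<inter> fst d)) \<times> (snd c' ` (fst c' \<inter> fst d')))"
        by (intro open_Times open_overlap[OF M] open_overlap[OF N] cc dd)
      fix z assume "z \<in> (snd c ` (fst c \<inter> fst d)) \<times> (snd c' ` (fst c' \<inter> fst d'))"
      then show "map_prod (transition c d) (transition c' d') z = transition C D z"
        using transition_prod_chart[OF chart_inj_on[OF M cc(2)] chart_inj_on[OF N cc(3)], of "fst z" "snd z" d d']
        unfolding cc(1) dd(1) by (auto simp: coord_range_def)
    qed
    moreover have "frame_det (frame ?P) (\<lambda>i. frechet_derivative (transition C D) (at x) (frame ?P i)) > 0"
      if x: "x \<in> snd C ` (fst C \<inter> fst D)" for x
    proof -
      obtain p q where pq: "p \<in> fst c \<inter> fst d" "q \<in> fst c' \<inter> fst d'" "x = (snd c p, snd c' q)"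
        using x unfolding cc(1) dd(1) prod_chart_overlap by blast
      let ?D1 = "frechet_derivative (transition c d) (at (snd c p))"
      let ?D2 = "frechet_derivative (transition c' d') (at (snd c' q))"
      have "?D1 0 = 0" "?D2 0 = 0"
        using has_derivative_linear[OF transition_has_derivative[OF M cc(2) dd(2) pq(1)]]
          has_derivative_linear[OF transition_has_derivative[OF N cc(3) dd(3) pq(2)]] linear_0 by blast+
      then have eq: "(\<lambda>i. frechet_derivative (transition C D) (at x) (frame ?P i)) =
         (\<lambda>i. if i < ?a then (?D1 (frame M i), 0) else (0, ?D2 (frame N (i - ?a))))"
        unfolding cc(1) dd(1) pq(3) frame
          frechet_derivative_transition_prod_chart[OF M cc(2) dd(2) pq(1) N cc(3) dd(3) pq(2)]
        by auto
      have "frame_det (frame ?P) (\<lambda>i. frechet_derivative (transition C D) (at x) (frame ?P i)) =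
          frame_det (frame M) (\<lambda>i. ?D1 (frame M i)) * frame_det (frame N) (\<lambda>i. ?D2 (frame N i))"
        unfolding eq unfolding frame by (rule frame_det_prod)
      also have "\<dots> > 0"
        using pq by (intro mult_pos_pos oriented_manifoldD(9)[OF M cc(2) dd(2)]
            oriented_manifoldD(9)[OF N cc(3) dd(3)]) blast+
      finally show ?thesis .
    qed
    ultimately show ?thesis unfolding cc(1) dd(1) prod_chart_overlap by blast
  qed
  have "(\<Union>C\<in>charts ?P. fst C) = (\<Union>c\<in>charts M. fst c) \<times> (\<Union>d\<in>charts N. fst d)"
    unfolding charts by fastforce
  then have "(\<Union>C\<in>charts ?P. fst C) = topspace (mtop ?P)"
    by (simp add: top oriented_manifoldD(4)[OF M] oriented_manifoldD(4)[OF N])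
  moreover have "Hausdorff_space (mtop ?P)" "second_countable (mtop ?P)"
    using oriented_manifoldD(1,2)[OF M] oriented_manifoldD(1,2)[OF N]
    by (auto simp: top Hausdorff_space_prod_topology second_countable_prod_topology)
  ultimately show ?thesis
    unfolding oriented_manifold_def using bij chart trans by blast
qed

section \<open>The two-sphere\<close>

lemma in_unit_sphere_3: "q \<in> sphere 0 1 \<longleftrightarrow> (q $ 1)\<^sup>2 + (q $ 2)\<^sup>2 + (q $ 3)\<^sup>2 = 1" for q :: "real^3"
  by (simp add: norm_eq_1 inner_vec_def sum_3 power2_eq_square)

text \<open>
  The two stereographic charts in one formula: \<open>s = 1\<close> is projection from the south pole and \<open>s = - 1\<close>
  projection from the north pole, where the factor \<open>s\<close> of the imaginary part is the conjugation.
\<close>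

definition stereo_chart :: "real \<Rightarrow> (real^3, complex) chart" where
  "stereo_chart s = (sphere 0 1 - {axis 3 (- s)},
     \<lambda>q. Complex (q $ 1 / (1 + s * q $ 3)) (s * q $ 2 / (1 + s * q $ 3)))"

definition stereo_inverse :: "real \<Rightarrow> complex \<Rightarrow> real^3" where
  "stereo_inverse s w = vector [2 * Re w / (1 + (cmod w)\<^sup>2), s * (2 * Im w) / (1 + (cmod w)\<^sup>2),
     s * (1 - (cmod w)\<^sup>2) / (1 + (cmod w)\<^sup>2)]"

lemma one_plus_cmod_pos: "1 + (cmod w)\<^sup>2 > 0"
  using zero_le_power2[of "cmod w"] by linarith

lemma charts_S2: "charts S2 = stereo_chart ` {1, - 1}"
  by (auto simp: S2_def stereo_chart_def S2_chart_south_def S2_chart_north_def)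

context
  fixes s :: real
  assumes s: "s \<in> {1, - 1}"
begin

lemma ss: "s * s = 1" "s * (s * x) = x"
  using s by auto

lemma stereo_denominator:
  assumes "q \<in> fst (stereo_chart s)"
  shows "1 + s * q $ 3 \<noteq> 0"
proof
  assume "1 + s * q $ 3 = 0"
  then have q3: "q $ 3 = - s" using s by auto
  have "(q $ 1)\<^sup>2 + (q $ 2)\<^sup>2 + (q $ 3)\<^sup>2 = 1"
    using assms in_unit_sphere_3[of q] by (simp add: stereo_chart_def)
  then have "(q $ 1)\<^sup>2 + (q $ 2)\<^sup>2 = 0" using q3 s by auto
  then have "q = axis 3 (- s)"
    using q3 by (simp add: vec_eq_iff forall_3 axis_def)
  then show False using assms by (simp add: stereo_chart_def)
qed

lemma stereo_inverse_mem: "stereo_inverse s w \<in> fst (stereo_chart s)"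
proof -
  let ?r = "(cmod w)\<^sup>2"
  have r: "?r = (Re w)\<^sup>2 + (Im w)\<^sup>2" by (rule cmod_power2)
  have "(2 * Re w)\<^sup>2 + (s * (2 * Im w))\<^sup>2 + (s * (1 - ?r))\<^sup>2 = (1 + ?r)\<^sup>2"
    unfolding r using s by (auto simp: power2_eq_square algebra_simps)
  then have "stereo_inverse s w \<in> sphere 0 1"
    using one_plus_cmod_pos[of w] unfolding in_unit_sphere_3 stereo_inverse_def
    by (simp add: vector_3 power_divide add_divide_distrib[symmetric])
  moreover have "stereo_inverse s w $ 3 \<noteq> - s"
    using one_plus_cmod_pos[of w] s by (auto simp: stereo_inverse_def vector_3 field_simps)
  then have "stereo_inverse s w \<noteq> axis 3 (- s)" by (auto simp: axis_def)
  ultimately show ?thesis by (simp add: stereo_chart_def)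
qed

lemma stereo_of_inverse: "snd (stereo_chart s) (stereo_inverse s w) = w"
proof -
  let ?r = "(cmod w)\<^sup>2"
  have "1 + s * (s * (1 - ?r) / (1 + ?r)) = 2 / (1 + ?r)"
    using one_plus_cmod_pos[of w] ss by (simp add: field_simps)
  then show ?thesis
    using one_plus_cmod_pos[of w]
    by (simp add: stereo_chart_def stereo_inverse_def vector_3 complex_eq_iff ss)
qed

lemma stereo_inverse_of:
  assumes "q \<in> fst (stereo_chart s)"
  shows "stereo_inverse s (snd (stereo_chart s) q) = q"
proof -
  let ?w = "snd (stereo_chart s) q"
  let ?t = "1 + s * q $ 3"
  have t: "?t \<noteq> 0" by (rule stereo_denominator[OF assms])
  have "(q $ 1)\<^sup>2 + (q $ 2)\<^sup>2 + (q $ 3)\<^sup>2 = 1"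
    using assms in_unit_sphere_3[of q] by (simp add: stereo_chart_def)
  then have "(q $ 1)\<^sup>2 + (s * q $ 2)\<^sup>2 = (1 - s * q $ 3) * ?t"
    using s by (auto simp: power2_eq_square algebra_simps)
  then have "(cmod ?w)\<^sup>2 = (1 - s * q $ 3) / ?t"
    using t unfolding cmod_power2 by (simp add: stereo_chart_def power_divide add_divide_distrib[symmetric] power2_eq_square)
  then have "1 + (cmod ?w)\<^sup>2 = 2 / ?t" "1 - (cmod ?w)\<^sup>2 = 2 * (s * q $ 3) / ?t"
    using t by (simp_all add: field_simps)
  then show ?thesis
    unfolding stereo_inverse_def using t ss
    by (simp add: vec_eq_iff forall_3 vector_3) (simp add: stereo_chart_def mult.assoc[symmetric])
qed

lemma coord_range_stereo: "coord_range (stereo_chart s) = UNIV"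
proof -
  have "w \<in> coord_range (stereo_chart s)" for w
    unfolding coord_range_def by (metis image_eqI stereo_of_inverse stereo_inverse_mem)
  then show ?thesis by blast
qed

lemma continuous_on_stereo: "continuous_on (fst (stereo_chart s)) (snd (stereo_chart s))"
  unfolding stereo_chart_def snd_conv Complex_eq
  by (intro continuous_intros) (use stereo_denominator in \<open>auto simp: stereo_chart_def\<close>)

lemma continuous_on_stereo_inverse: "continuous_on UNIV (stereo_inverse s)"
proof -
  have "stereo_inverse s = (\<lambda>w. (2 * Re w / (1 + (cmod w)\<^sup>2)) *\<^sub>R axis 1 1 +
      (s * (2 * Im w) / (1 + (cmod w)\<^sup>2)) *\<^sub>R axis 2 1 + (s * (1 - (cmod w)\<^sup>2) / (1 + (cmod w)\<^sup>2)) *\<^sub>R axis 3 1)"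
    by (simp add: fun_eq_iff stereo_inverse_def vec_eq_iff forall_3 vector_3 axis_def)
  moreover have "1 + (cmod w)\<^sup>2 \<noteq> 0" for w using one_plus_cmod_pos[of w] by linarith
  ultimately show ?thesis
    by (simp only:) (intro continuous_intros; simp)
qed

lemma homeomorphic_map_stereo:
  "homeomorphic_map (subtopology (mtop S2) (fst (stereo_chart s)))
     (top_of_set (coord_range (stereo_chart s))) (snd (stereo_chart s))"
proof (rule homeomorphic_maps_imp_map)
  have top: "subtopology (mtop S2) (fst (stereo_chart s)) = top_of_set (fst (stereo_chart s))"
    by (simp add: S2_def stereo_chart_def subtopology_subtopology Int_absorb1 Diff_subset)
  show "homeomorphic_maps (subtopology (mtop S2) (fst (stereo_chart s)))
     (top_of_set (coord_range (stereo_chart s))) (snd (stereo_chart s)) (stereo_inverse s)"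
    unfolding top homeomorphic_maps_def coord_range_stereo
    using continuous_on_stereo continuous_on_stereo_inverse stereo_inverse_mem
      stereo_of_inverse stereo_inverse_of
    by (auto simp: continuous_map_in_subtopology)
qed

text \<open>
  On the unit sphere \<open>(1 + q\<^sub>3) (1 - q\<^sub>3) = q\<^sub>1\<^sup>2 + q\<^sub>2\<^sup>2\<close>, so the coordinates for the two poles have
  product 1 once one of them is conjugated.
\<close>

lemma stereo_opposite:
  assumes "w \<noteq> 0"
  shows "stereo_inverse s w \<in> fst (stereo_chart (- s))"
    and "snd (stereo_chart (- s)) (stereo_inverse s w) = inverse w"
proof -
  let ?r = "(cmod w)\<^sup>2"
  have r: "?r \<noteq> 0" using assms by simp
  have r2: "?r = (Re w)\<^sup>2 + (Im w)\<^sup>2" by (rule cmod_power2)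
  have "snd (stereo_chart s) (axis 3 s) = 0"
    by (simp add: stereo_chart_def axis_def complex_eq_iff)
  then have "stereo_inverse s w \<noteq> axis 3 s" using stereo_of_inverse[of w] assms by auto
  then show "stereo_inverse s w \<in> fst (stereo_chart (- s))"
    using stereo_inverse_mem[of w] by (simp add: stereo_chart_def)
  have "1 - s * (s * (1 - ?r) / (1 + ?r)) = 2 * ?r / (1 + ?r)"
    using one_plus_cmod_pos[of w] ss by (simp add: field_simps)
  then show "snd (stereo_chart (- s)) (stereo_inverse s w) = inverse w"
  proof -
    assume *: "1 - s * (s * (1 - ?r) / (1 + ?r)) = 2 * ?r / (1 + ?r)"
    have "snd (stereo_chart (- s)) (stereo_inverse s w) = Complex (Re w / ?r) (- Im w / ?r)"
      using * one_plus_cmod_pos[of w] r by (simp add: stereo_chart_def stereo_inverse_def vector_3 ss)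
    also have "\<dots> = inverse w" by (simp add: complex_eq_iff r2)
    finally show ?thesis .
  qed
qed

lemma stereo_overlap:
  "snd (stereo_chart s) ` (fst (stereo_chart s) \<inter> fst (stereo_chart (- s))) = - {0}"
proof
  show "- {0} \<subseteq> snd (stereo_chart s) ` (fst (stereo_chart s) \<inter> fst (stereo_chart (- s)))"
  proof
    fix w :: complex assume "w \<in> - {0}"
    then have "stereo_inverse s w \<in> fst (stereo_chart s) \<inter> fst (stereo_chart (- s))"
      using stereo_inverse_mem stereo_opposite(1) by blast
    from imageI[OF this, of "snd (stereo_chart s)"]
    show "w \<in> snd (stereo_chart s) ` (fst (stereo_chart s) \<inter> fst (stereo_chart (- s)))"
      by (simp only: stereo_of_inverse)
  qed
next
  have nz: "snd (stereo_chart s) q \<noteq> 0" if q: "q \<in> fst (stereo_chart s)" "q \<noteq> axis 3 s" for q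
  proof
    assume *: "snd (stereo_chart s) q = 0"
    have "snd (stereo_chart s) (axis 3 s) = 0"
      by (simp add: stereo_chart_def axis_def complex_eq_iff)
    moreover have "axis 3 s \<in> fst (stereo_chart s)"
    proof -
      have "(axis 3 s :: real^3) \<in> sphere 0 1" unfolding in_unit_sphere_3 using s by (auto simp: axis_def)
      moreover have "axis 3 s \<noteq> (axis 3 (- s) :: real^3)" using s by (auto simp: axis_eq_axis)
      ultimately show ?thesis by (simp add: stereo_chart_def)
    qed
    ultimately show False using stereo_inverse_of[OF q(1)] stereo_inverse_of[of "axis 3 s"] * q(2) by simp
  qed
  show "snd (stereo_chart s) ` (fst (stereo_chart s) \<inter> fst (stereo_chart (- s))) \<subseteq> - {0}"
  proof (intro subsetI)
    fix w assume "w \<in> snd (stereo_chart s) ` (fst (stereo_chart s) \<inter> fst (stereo_chart (- s)))"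
    then obtain q where q: "q \<in> fst (stereo_chart s)" "q \<in> fst (stereo_chart (- s))"
      "w = snd (stereo_chart s) q" by blast
    have "q \<noteq> axis 3 s" using q(2) by (simp add: stereo_chart_def)
    from nz[OF q(1) this] show "w \<in> - {0}" by (simp only: q(3) Compl_iff singleton_iff not_False_eq_True)
  qed
qed

lemma transition_stereo: "transition (stereo_chart s) d w = snd d (stereo_inverse s w)"
proof -
  have "inv_into (fst (stereo_chart s)) (snd (stereo_chart s)) w = stereo_inverse s w"
  proof (rule inv_into_f_eq)
    show "inj_on (snd (stereo_chart s)) (fst (stereo_chart s))"
      by (rule inj_on_inverseI) (rule stereo_inverse_of)
  qed (rule stereo_inverse_mem stereo_of_inverse)+
  then show ?thesis by (simp add: transition_def)
qed

end

lemma stereo_pair_cases: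
  assumes "c \<in> charts S2" "d \<in> charts S2"
  obtains s where "s \<in> {1, - 1}" "c = stereo_chart s" "d = stereo_chart s" |
    s where "s \<in> {1, - 1}" "c = stereo_chart s" "d = stereo_chart (- s)"
  using assms unfolding charts_S2 by fastforce

lemma S2_transition_smooth:
  assumes "c \<in> charts S2" "d \<in> charts S2"
  shows "smooth_on (snd c ` (fst c \<inter> fst d)) (transition c d)"
  using assms
proof (cases rule: stereo_pair_cases)
  case (1 s)
  have "transition c d = (\<lambda>w. w)"
    unfolding 1(2,3) by (rule ext) (simp only: transition_stereo[OF 1(1)] stereo_of_inverse[OF 1(1)])
  moreover have "snd c ` (fst c \<inter> fst d) = UNIV"
    using coord_range_stereo[OF 1(1)] 1 by (simp add: coord_range_def)
  ultimately show ?thesis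
    by (simp add: smooth_on_def Ck_on_bounded_linear bounded_linear_ident)
next
  case (2 s)
  have o: "snd c ` (fst c \<inter> fst d) = - {0}"
    using stereo_overlap[OF 2(1)] 2 by simp
  have "smooth_on (- {0}) (transition c d)"
  proof (rule smooth_on_cong)
    show "smooth_on (- {0}) (\<lambda>w::complex. inverse w)"
      unfolding smooth_on_def
      by (intro allI Ck_on_inverse Ck_on_bounded_linear bounded_linear_ident) auto
    show "inverse w = transition c d w" if "w \<in> - {0}" for w
      using transition_stereo[OF 2(1)] stereo_opposite(2)[OF 2(1)] 2 that by auto
  qed auto
  then show ?thesis by (simp add: o)
qed

text \<open>
  The derivative of \<open>w \<mapsto> 1 / w\<close> is multiplication by \<open>a = - 1 / w\<^sup>2\<close>. The last equation says that
  this map preserves the round metric \<open>4 \<bar>dw\<bar>\<^sup>2 / (1 + \<bar>w\<bar>\<^sup>2)\<^sup>2\<close>. Multiplication by a nonzero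
  complex number preserves the orientation, so both properties of the charts that matter
  can be read off here.
\<close>

lemma S2_transition_conformal:
  assumes c: "c \<in> charts S2" and d: "d \<in> charts S2" and w: "w \<in> snd c ` (fst c \<inter> fst d)"
  obtains a where "a \<noteq> 0" "frechet_derivative (transition c d) (at w) = (\<lambda>h. a * h)"
    "cmod a * (1 + (cmod w)\<^sup>2) = 1 + (cmod (transition c d w))\<^sup>2"
  using c d
proof (cases rule: stereo_pair_cases)
  case (1 s)
  have "transition c d = (\<lambda>w. w)"
    unfolding 1(2,3) by (rule ext) (simp only: transition_stereo[OF 1(1)] stereo_of_inverse[OF 1(1)])
  then show ?thesis using that[of 1] by (simp add: frechet_derivative_ident)
next
  case (2 s)
  have o: "w \<noteq> 0"
    using stereo_overlap[OF 2(1)] 2 w by auto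
  have t: "transition c d w = inverse w" if "w \<in> - {0}" for w
    using transition_stereo[OF 2(1)] stereo_opposite(2)[OF 2(1)] 2 that by auto
  have "((\<lambda>w. inverse w) has_derivative (\<lambda>h. - (inverse w * h * inverse w))) (at w)"
    by (rule Deriv.has_derivative_inverse[OF o has_derivative_ident])
  then have "(transition c d has_derivative (\<lambda>h. - (inverse w * h * inverse w))) (at w)"
    by (rule has_derivative_transform_within_open[of _ _ _ _ "- {0}"]) (use o t in auto)
  from frechet_derivative_at[OF this]
  have "frechet_derivative (transition c d) (at w) = (\<lambda>h. (- (inverse w * inverse w)) * h)"
    by (simp add: mult_ac)
  moreover have "cmod (- (inverse w * inverse w)) * (1 + (cmod w)\<^sup>2) = 1 + (cmod (transition c d w))\<^sup>2"
  proof -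
    have "transition c d w = inverse w" using o t by simp
    then show ?thesis
      using o by (simp only: norm_minus_cancel norm_mult norm_inverse) (simp add: field_simps power2_eq_square)
  qed
  ultimately show ?thesis using that[of "- (inverse w * inverse w)"] o by simp
qed

lemma frame_det_complex:
  "frame_det (\<lambda>i. [1, \<i>] ! i) v = Im (cnj (v 0) * v 1)"
  unfolding frame_det_def DIM_complex sum_permutations_2
  by (simp add: sign_swap_id numeral_2_eq_2 inner_complex_def algebra_simps)

lemma second_countable_euclidean: "second_countable (euclidean :: 'a::second_countable_topology topology)"
proof -
  obtain B :: "'a set set" where B: "countable B" "topological_basis B"
    using ex_countable_basis by blast
  have "\<forall>V\<in>B. openin euclidean V" using topological_basis_open[OF B(2)] by simp
  moreover have "\<forall>U x. openin euclidean U \<and> x \<in> U \<longrightarrow> (\<exists>V\<in>B. x \<in> V \<and> V \<subseteq> U)"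
    using topological_basisE[OF B(2)] by (metis open_openin)
  ultimately show ?thesis
    unfolding second_countable_def using B(1) by blast
qed

lemma oriented_manifold_S2: "oriented_manifold S2"
proof -
  have top: "mtop S2 = top_of_set (sphere 0 1)" and fr: "frame S2 = (\<lambda>i. [1, \<i>] ! i)"
    by (simp_all add: S2_def)
  have haus: "Hausdorff_space (mtop S2)" and sec: "second_countable (mtop S2)"
    unfolding top by (intro Hausdorff_space_subtopology Hausdorff_space_euclidean
        second_countable_subtopology second_countable_euclidean)+
  have bij: "bij_betw (frame S2) {..<DIM(complex)} Basis"
  proof -
    have "{..<DIM(complex)} = {0, 1}" by auto
    then show ?thesis unfolding fr by (simp add: bij_betw_def Basis_complex_def complex_eq_iff)
  qed
  have cover: "(\<Union>c\<in>charts S2. fst c) = topspace (mtop S2)"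
  proof -
    have "axis 3 1 \<noteq> (axis 3 (- 1) :: real^3)" by (simp add: axis_eq_axis)
    then show ?thesis unfolding charts_S2 top by (auto simp: stereo_chart_def)
  qed
  have chart: "openin (mtop S2) (fst c) \<and> open (coord_range c) \<and>
        homeomorphic_map (subtopology (mtop S2) (fst c)) (top_of_set (coord_range c)) (snd c)"
    if c: "c \<in> charts S2" for c
  proof -
    obtain s where s: "s \<in> {1, - 1}" "c = stereo_chart s" using c unfolding charts_S2 by auto
    have "openin (mtop S2) (fst c)"
      unfolding top s(2) stereo_chart_def fst_conv by (rule openin_delete[OF openin_subtopology_self])
    then show ?thesis
      using homeomorphic_map_stereo[OF s(1)] coord_range_stereo[OF s(1)] unfolding s(2) by auto
  qed
  have det: "frame_det (frame S2) (\<lambda>i. frechet_derivative (transition c d) (at w) (frame S2 i)) > 0"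
    if cd: "c \<in> charts S2" "d \<in> charts S2" and w: "w \<in> snd c ` (fst c \<inter> fst d)" for c d w
  proof -
    obtain a where a: "a \<noteq> 0" "frechet_derivative (transition c d) (at w) = (\<lambda>h. a * h)"
      using S2_transition_conformal[OF cd w] by metis
    have "frame_det (frame S2) (\<lambda>i. frechet_derivative (transition c d) (at w) (frame S2 i)) = (cmod a)\<^sup>2"
      unfolding fr frame_det_complex a(2) cmod_power2 by (simp add: power2_eq_square)
    then show ?thesis using a(1) by simp
  qed
  show ?thesis
    unfolding oriented_manifold_def
    by (intro conjI ballI haus sec bij cover S2_transition_smooth det chart[THEN conjunct1]
        chart[THEN conjunct2, THEN conjunct1] chart[THEN conjunct2, THEN conjunct2]; assumption)
qed

section \<open>Alternating forms\<close>

lemma alternating_formI: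
  assumes "\<And>v w. (\<And>i. i < k \<Longrightarrow> v i = w i) \<Longrightarrow> \<alpha> v = \<alpha> w"
    and "\<And>v i. i < k \<Longrightarrow> linear (\<lambda>u. \<alpha> (v(i := u)))"
    and "\<And>v i j. i < k \<Longrightarrow> j < k \<Longrightarrow> i \<noteq> j \<Longrightarrow> v i = v j \<Longrightarrow> \<alpha> v = 0"
  shows "alternating_form k \<alpha>"
  unfolding alternating_form_def
  by (intro conjI allI impI; (elim conjE)?; rule assms) (assumption | simp)+

lemma alternating_form_local:
  "alternating_form k \<alpha> \<Longrightarrow> (\<And>i. i < k \<Longrightarrow> v i = w i) \<Longrightarrow> \<alpha> v = \<alpha> w"
  unfolding alternating_form_def by simp

lemma alternating_form_linear:
  "alternating_form k \<alpha> \<Longrightarrow> i < k \<Longrightarrow> linear (\<lambda>u. \<alpha> (v(i := u)))"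
  unfolding alternating_form_def by simp

lemma alternating_form_repeated:
  "alternating_form k \<alpha> \<Longrightarrow> i < k \<Longrightarrow> j < k \<Longrightarrow> i \<noteq> j \<Longrightarrow> v i = v j \<Longrightarrow> \<alpha> v = 0"
  unfolding alternating_form_def by meson

lemma alternating_form_zero:
  assumes "alternating_form k \<alpha>" "i < k" "v i = 0"
  shows "\<alpha> v = 0"
  using linear_0[OF alternating_form_linear[OF assms(1,2), of v]] assms(3) by (metis fun_upd_triv)

lemma alternating_form_linear_pullback:
  assumes \<alpha>: "alternating_form k \<alpha>" and L: "linear L"
  shows "alternating_form k (\<lambda>v. \<alpha> (\<lambda>i. L (v i)))"
proof (rule alternating_formI)
  show "(\<And>i. i < k \<Longrightarrow> v i = w i) \<Longrightarrow> \<alpha> (\<lambda>i. L (v i)) = \<alpha> (\<lambda>i. L (w i))" for v w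
    by (rule alternating_form_local[OF \<alpha>]) simp
  show "linear (\<lambda>u. \<alpha> (\<lambda>j. L ((v(i := u)) j)))" if "i < k" for v i
  proof -
    have "linear (\<lambda>u. \<alpha> ((\<lambda>j. L (v j))(i := L u)))"
      using linear_compose[OF L alternating_form_linear[OF \<alpha> that]] by (simp add: o_def)
    moreover have "(\<lambda>j. L (v j))(i := L u) = (\<lambda>j. L ((v(i := u)) j))" for u by auto
    ultimately show ?thesis by simp
  qed
  show "i < k \<Longrightarrow> j < k \<Longrightarrow> i \<noteq> j \<Longrightarrow> v i = v j \<Longrightarrow> \<alpha> (\<lambda>i. L (v i)) = 0" for v i j
    using alternating_form_repeated[OF \<alpha>, of i j "\<lambda>i. L (v i)"] by simp
qed

lemma alternating_form_add:
  assumes \<alpha>: "alternating_form k \<alpha>" and \<beta>: "alternating_form k \<beta>"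
  shows "alternating_form k (\<lambda>v. \<alpha> v + \<beta> v)"
proof (rule alternating_formI)
  show "(\<And>i. i < k \<Longrightarrow> v i = w i) \<Longrightarrow> \<alpha> v + \<beta> v = \<alpha> w + \<beta> w" for v w
    using alternating_form_local[OF \<alpha>, of v w] alternating_form_local[OF \<beta>, of v w] by simp
  show "i < k \<Longrightarrow> linear (\<lambda>u. \<alpha> (v(i := u)) + \<beta> (v(i := u)))" for v i
    by (rule linear_compose_add[OF alternating_form_linear[OF \<alpha>] alternating_form_linear[OF \<beta>]])
  show "i < k \<Longrightarrow> j < k \<Longrightarrow> i \<noteq> j \<Longrightarrow> v i = v j \<Longrightarrow> \<alpha> v + \<beta> v = 0" for v i j
    using alternating_form_repeated[OF \<alpha>, of i j v] alternating_form_repeated[OF \<beta>, of i j v] by simp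
qed

lemma vpair_comp: "(\<lambda>i. f (vpair u w i)) = vpair (f u) (f w)"
  by (auto simp: vpair_def)

lemma wedge_one_form_power_vpair:
  assumes \<mu>: "alternating_form 1 \<mu>" and \<alpha>: "alternating_form 2 \<alpha>"
  shows "wedge 1 (2 * j) \<mu> (wedge_power \<alpha> j) v = (\<Sum>p | p permutes {..<2 * j + 1}.
     of_int (sign p) * \<mu> (\<lambda>_. v (p 0)) *
       (\<Prod>k<j. \<alpha> (vpair (v (p (2 * k + 1))) (v (p (2 * k + 2)))))) / 2 ^ j"
proof -
  have 1: "\<mu> (\<lambda>i. v (p i)) = \<mu> (\<lambda>_. v (p 0))" for p
    by (rule alternating_form_local[OF \<mu>]) simp
  have 2: "\<alpha> (\<lambda>i. v (p (2 * k + 1 + i))) = \<alpha> (vpair (v (p (2 * k + 1))) (v (p (2 * k + 2))))" for p k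
    by (rule alternating_form_local[OF \<alpha>]) (auto simp: vpair_def less_2_cases_iff)
  have "wedge 1 (2 * j) \<mu> (wedge_power \<alpha> j) v = (\<Sum>p | p permutes {..<2 * j + 1}.
     of_int (sign p) * \<mu> (\<lambda>i. v (p i)) * (\<Prod>k<j. \<alpha> (\<lambda>i. v (p (2 * k + 1 + i))))) / 2 ^ j"
  proof (rule wedge_one_form_power_eq_sum)
    show "v 0 = w 0 \<Longrightarrow> \<mu> v = \<mu> w" for v w
      by (rule alternating_form_local[OF \<mu>]) simp
    show "v 0 = w 0 \<Longrightarrow> v 1 = w 1 \<Longrightarrow> \<alpha> v = \<alpha> w" for v w
      by (rule alternating_form_local[OF \<alpha>]) (auto simp: less_2_cases_iff)
  qed
  also have "\<dots> = (\<Sum>p | p permutes {..<2 * j + 1}. of_int (sign p) * \<mu> (\<lambda>_. v (p 0)) *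
       (\<Prod>k<j. \<alpha> (vpair (v (p (2 * k + 1))) (v (p (2 * k + 2)))))) / 2 ^ j"
    by (intro arg_cong2[where f = "(/)"] sum.cong arg_cong2[where f = "(*)"] prod.cong refl 1 2)
  finally show ?thesis .
qed

text \<open>
  The identity \<open>\<mu> \<and> (\<beta> + \<sigma>)\<^sup>m\<^sup>+\<^sup>1 = (m + 1) (\<nu> \<and> \<beta>\<^sup>m) \<and> \<sigma>\<close>, evaluated on a frame \<open>f\<close> that consists
  of a frame \<open>g\<close> for \<open>\<nu>\<close> and \<open>\<beta>\<close> followed by a basis of a plane with area form \<open>\<sigma>\<close>, the plane being
  orthogonal to \<open>g\<close>.
\<close>

lemma wedge_extra_plane:
  fixes \<mu> \<alpha> :: "'f::real_vector covector" and \<nu> \<beta> :: "'e::real_vector covector" and m :: nat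
  defines "a \<equiv> 2 * m + 1"
  assumes alt: "alternating_form 1 \<mu>" "alternating_form 2 \<alpha>" "alternating_form 1 \<nu>" "alternating_form 2 \<beta>"
    and \<mu>: "\<And>i. i < a \<Longrightarrow> \<mu> (\<lambda>_. f i) = \<nu> (\<lambda>_. g i)" "\<mu> (\<lambda>_. f a) = 0" "\<mu> (\<lambda>_. f (a + 1)) = 0"
    and \<alpha>: "\<And>i j. i < a \<Longrightarrow> j < a \<Longrightarrow> \<alpha> (vpair (f i) (f j)) = \<beta> (vpair (g i) (g j))"
      "\<And>i j. i < a \<Longrightarrow> a \<le> j \<Longrightarrow> \<alpha> (vpair (f i) (f j)) = 0"
      "\<And>i j. a \<le> i \<Longrightarrow> j < a \<Longrightarrow> \<alpha> (vpair (f i) (f j)) = 0"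
    and s: "\<alpha> (vpair (f a) (f (a + 1))) = s" "\<alpha> (vpair (f (a + 1)) (f a)) = - s"
  shows "wedge 1 (2 * Suc m) \<mu> (wedge_power \<alpha> (Suc m)) f =
     real (Suc m) * s * wedge 1 (2 * m) \<nu> (wedge_power \<beta> m) g"
proof -
  let ?L = "\<Sum>p | p permutes {..<a + 2}. of_int (sign p) * \<mu> (\<lambda>_. f (p 0)) *
       (\<Prod>k<Suc m. \<alpha> (vpair (f (p (2 * k + 1))) (f (p (2 * k + 2)))))"
  let ?R = "\<Sum>q | q permutes {..<a}. of_int (sign q) * \<mu> (\<lambda>_. f (q 0)) *
       (\<Prod>k<m. \<alpha> (vpair (f (q (2 * k + 1))) (f (q (2 * k + 2)))))"
  let ?Q = "\<Sum>q | q permutes {..<a}. of_int (sign q) * \<nu> (\<lambda>_. g (q 0)) *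
       (\<Prod>k<m. \<beta> (vpair (g (q (2 * k + 1))) (g (q (2 * k + 2)))))"
  have "?L = 2 * real (Suc m) * s * ?R"
    unfolding a_def
    by (rule sum_permutations_extra_pair[where M = "\<lambda>i. \<mu> (\<lambda>_. f i)" and W = "\<lambda>i j. \<alpha> (vpair (f i) (f j))"])
      (use \<mu> \<alpha> s in \<open>simp_all add: a_def\<close>)
  also have "?R = ?Q"
  proof (intro sum.cong refl)
    fix q assume "q \<in> {q. q permutes {..<a}}"
    then have "q i < a" if "i < a" for i using permutes_in_image[of q "{..<a}" i] that by simp
    then have q: "q i < a" if "i \<le> 2 * m" for i using that by (simp add: a_def)
    have "\<mu> (\<lambda>_. f (q 0)) = \<nu> (\<lambda>_. g (q 0))" by (rule \<mu>(1)[OF q]) simp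
    moreover have "(\<Prod>k<m. \<alpha> (vpair (f (q (2 * k + 1))) (f (q (2 * k + 2))))) =
        (\<Prod>k<m. \<beta> (vpair (g (q (2 * k + 1))) (g (q (2 * k + 2)))))"
      by (intro prod.cong refl \<alpha>(1) q) auto
    ultimately show "of_int (sign q) * \<mu> (\<lambda>_. f (q 0)) *
        (\<Prod>k<m. \<alpha> (vpair (f (q (2 * k + 1))) (f (q (2 * k + 2))))) =
      of_int (sign q) * \<nu> (\<lambda>_. g (q 0)) *
        (\<Prod>k<m. \<beta> (vpair (g (q (2 * k + 1))) (g (q (2 * k + 2)))))" by simp
  qed
  finally have L: "?L = 2 * real (Suc m) * s * ?Q" .
  have a2: "2 * Suc m + 1 = a + 2" by (simp add: a_def)
  have "wedge 1 (2 * Suc m) \<mu> (wedge_power \<alpha> (Suc m)) f = ?L / 2 ^ Suc m"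
    by (rule wedge_one_form_power_vpair[OF alt(1,2), of "Suc m" f, unfolded a2])
  moreover have "wedge 1 (2 * m) \<nu> (wedge_power \<beta> m) g = ?Q / 2 ^ m"
    using wedge_one_form_power_vpair[OF alt(3,4), of m g] by (simp only: a_def)
  moreover have "2 * r * s * q / 2 ^ Suc m = r * s * (q / 2 ^ m)" for r q by simp
  ultimately show ?thesis by (simp only: L)
qed

section \<open>Differential forms\<close>

lemma diff_formD:
  assumes "diff_form M k \<omega>" and c: "c \<in> charts M"
  shows "\<And>x. x \<in> coord_range c \<Longrightarrow> alternating_form k (\<omega> c x)"
    and "\<And>v. smooth_on (coord_range c) (\<lambda>x. \<omega> c x v)"
    and "\<And>d p v. d \<in> charts M \<Longrightarrow> p \<in> fst c \<inter> fst d \<Longrightarrow> \<omega> c (snd c p) v =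
        \<omega> d (snd d p) (\<lambda>i. frechet_derivative (transition c d) (at (snd c p)) (v i))"
proof -
  note \<omega> = assms(1)[unfolded diff_form_def]
  show "alternating_form k (\<omega> c x)" if "x \<in> coord_range c" for x
    by (rule \<omega>[THEN conjunct1, THEN bspec, OF c, THEN conjunct1, THEN bspec, OF that])
  show "smooth_on (coord_range c) (\<lambda>x. \<omega> c x v)" for v
    by (rule \<omega>[THEN conjunct1, THEN bspec, OF c, THEN conjunct2, THEN spec])
  show "\<omega> c (snd c p) v = \<omega> d (snd d p) (\<lambda>i. frechet_derivative (transition c d) (at (snd c p)) (v i))"
    if "d \<in> charts M" "p \<in> fst c \<inter> fst d" for d p v
    by (rule \<omega>[THEN conjunct2, THEN bspec, OF c, THEN bspec, OF that(1), THEN bspec, OF that(2), THEN spec])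
qed

lemma diff_form_differentiable:
  assumes "diff_form M k \<omega>" "c \<in> charts M" "x \<in> coord_range c"
  shows "(\<lambda>x. \<omega> c x v) differentiable (at x)"
  using smooth_on_has_derivative[OF diff_formD(2)[OF assms(1,2)] assms(3)]
  by (rule differentiableI)

text \<open>
  In charts, the inclusion of the zero section and the projection of a product are linear maps, so
  this is why the exterior derivative commutes with the pullbacks used below.
\<close>

lemma frechet_derivative_compose_affine:
  assumes L: "bounded_linear L" and f: "f differentiable (at (L x + b))"
  shows "frechet_derivative (\<lambda>y. f (L y + b)) (at x) h = frechet_derivative f (at (L x + b)) (L h)"
proof -
  have "((\<lambda>y. L y + b) has_derivative L) (at x)"
    using has_derivative_add[OF bounded_linear_imp_has_derivative[OF L] has_derivative_const] by simp
  from has_derivative_compose[OF this f[unfolded frechet_derivative_works]]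
  have "((\<lambda>y. f (L y + b)) has_derivative (\<lambda>h. frechet_derivative f (at (L x + b)) (L h))) (at x)" .
  from frechet_derivative_at[OF this] show ?thesis by metis
qed

lemma diff_form_add:
  assumes M: "oriented_manifold M" and \<alpha>: "diff_form M k \<alpha>" and \<beta>: "diff_form M k \<beta>"
  shows "diff_form M k (\<lambda>c x v. \<alpha> c x v + \<beta> c x v)"
  unfolding diff_form_def
proof (intro conjI ballI allI)
  fix c x v assume c: "c \<in> charts M"
  show "x \<in> coord_range c \<Longrightarrow> alternating_form k (\<lambda>v. \<alpha> c x v + \<beta> c x v)"
    by (rule alternating_form_add[OF diff_formD(1)[OF \<alpha> c] diff_formD(1)[OF \<beta> c]])
  show "smooth_on (coord_range c) (\<lambda>x. \<alpha> c x v + \<beta> c x v)"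
    using diff_formD(2)[OF \<alpha> c, of v] diff_formD(2)[OF \<beta> c, of v] oriented_manifoldD(6)[OF M c]
    unfolding smooth_on_def by (intro allI Ck_on_add) auto
  fix d p assume d: "d \<in> charts M" "p \<in> fst c \<inter> fst d"
  show "\<alpha> c (snd c p) v + \<beta> c (snd c p) v =
    \<alpha> d (snd d p) (\<lambda>i. frechet_derivative (transition c d) (at (snd c p)) (v i)) +
    \<beta> d (snd d p) (\<lambda>i. frechet_derivative (transition c d) (at (snd c p)) (v i))"
    using diff_formD(3)[OF \<alpha> c d] diff_formD(3)[OF \<beta> c d] by simp
qed

lemma closed_form_add:
  assumes \<alpha>: "diff_form M k \<alpha>" "closed_form M k \<alpha>" and \<beta>: "diff_form M k \<beta>" "closed_form M k \<beta>"
  shows "closed_form M k (\<lambda>c x v. \<alpha> c x v + \<beta> c x v)"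
  unfolding closed_form_def
proof (intro ballI allI)
  fix c x v assume c: "c \<in> charts M" and x: "x \<in> coord_range c"
  have "frechet_derivative (\<lambda>y. \<alpha> c y u + \<beta> c y u) (at x) h =
      frechet_derivative (\<lambda>y. \<alpha> c y u) (at x) h + frechet_derivative (\<lambda>y. \<beta> c y u) (at x) h" for u h
    using frechet_derivative_at[OF has_derivative_add[OF
          diff_form_differentiable[OF \<alpha>(1) c x, unfolded frechet_derivative_works]
          diff_form_differentiable[OF \<beta>(1) c x, unfolded frechet_derivative_works]], of u u] by metis
  then have "ext_deriv k (\<lambda>c x v. \<alpha> c x v + \<beta> c x v) c x v = ext_deriv k \<alpha> c x v + ext_deriv k \<beta> c x v"
    unfolding ext_deriv_def by (simp add: distrib_left sum.distrib)
  then show "ext_deriv k (\<lambda>c x v. \<alpha> c x v + \<beta> c x v) c x v = 0"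
    using \<alpha>(2) \<beta>(2) c x unfolding closed_form_def by simp
qed

section \<open>Restriction to the zero section\<close>

lemma coord_range_R3_chart: "coord_range R3_chart = UNIV"
  by (simp add: coord_range_def R3_chart_def)

lemma R3_chart_in_charts: "R3_chart \<in> charts R3"
  by (simp add: R3_def)

lemma R3_product_charts: "c \<in> charts Z \<Longrightarrow> prod_chart c R3_chart \<in> charts (Z \<times>\<^sub>M R3)"
  using R3_chart_in_charts unfolding charts_prod_manifold by blast

lemma zero_section_coord: "x \<in> coord_range c \<Longrightarrow> (x, 0) \<in> coord_range (prod_chart c R3_chart)"
  by (simp add: coord_range_prod_chart coord_range_R3_chart)

lemma bounded_linear_zero_section: "bounded_linear (\<lambda>x. (x, 0))"
  by (intro bounded_linear_Pair bounded_linear_ident bounded_linear_zero)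

lemma diff_form_restrict_to_zero:
  assumes Z: "oriented_manifold Z" and \<omega>: "diff_form (Z \<times>\<^sub>M R3) k \<omega>"
  shows "diff_form Z k (restrict_to_zero \<omega>)"
  unfolding diff_form_def
proof (intro conjI ballI allI)
  fix c x v assume c: "c \<in> charts Z"
  note C = R3_product_charts[OF c]
  show "x \<in> coord_range c \<Longrightarrow> alternating_form k (restrict_to_zero \<omega> c x)"
    using alternating_form_linear_pullback[OF diff_formD(1)[OF \<omega> C zero_section_coord]
        bounded_linear.linear[OF bounded_linear_zero_section]]
    unfolding restrict_to_zero_def .
  show "smooth_on (coord_range c) (\<lambda>x. restrict_to_zero \<omega> c x v)"
    unfolding smooth_on_def
  proof
    fix j
    have "Ck_on j (coord_range c) (\<lambda>x. \<omega> (prod_chart c R3_chart) ((x, 0) + 0) (\<lambda>i. (v i, 0)))"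
    proof (rule Ck_on_compose_affine[OF bounded_linear_zero_section oriented_manifoldD(6)[OF Z c]])
      show "Ck_on j (coord_range (prod_chart c R3_chart)) (\<lambda>z. \<omega> (prod_chart c R3_chart) z (\<lambda>i. (v i, 0)))"
        using diff_formD(2)[OF \<omega> C] unfolding smooth_on_def by blast
    qed (simp add: zero_section_coord)
    then show "Ck_on j (coord_range c) (\<lambda>x. restrict_to_zero \<omega> c x v)"
      by (simp add: restrict_to_zero_def)
  qed
  fix d p assume d: "d \<in> charts Z" and p: "p \<in> fst c \<inter> fst d"
  let ?D = "frechet_derivative (transition c d) (at (snd c p))"
  have "(transition R3_chart R3_chart has_derivative (\<lambda>h. h)) (at 0)"
    by (simp add: transition_def R3_chart_def comp_def inv_into_f_f)
  moreover have "snd c p \<in> coord_range c" using p by (simp add: coord_range_def)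
  ultimately have "(transition (prod_chart c R3_chart) (prod_chart d R3_chart) has_derivative
      (\<lambda>h. (?D (fst h), snd h))) (at (snd c p, 0))"
    using transition_has_derivative[OF Z c d p]
    by (intro transition_prod_chart_has_derivative chart_inj_on[OF Z c] oriented_manifoldD(6)[OF Z c])
      (simp_all add: coord_range_R3_chart, simp add: R3_chart_def)
  from frechet_derivative_at[OF this]
  have D: "frechet_derivative (transition (prod_chart c R3_chart) (prod_chart d R3_chart)) (at (snd c p, 0)) =
      (\<lambda>h. (?D (fst h), snd h))" by simp
  have "(p, 0) \<in> fst (prod_chart c R3_chart) \<inter> fst (prod_chart d R3_chart)"
    using p by (simp add: R3_chart_def)
  from diff_formD(3)[OF \<omega> C R3_product_charts[OF d] this, of "\<lambda>i. (v i, 0)"]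
  show "restrict_to_zero \<omega> c (snd c p) v =
     restrict_to_zero \<omega> d (snd d p) (\<lambda>i. ?D (v i))"
    by (simp add: restrict_to_zero_def R3_chart_def D[unfolded R3_chart_def])
qed

lemma closed_form_restrict_to_zero:
  assumes \<omega>: "diff_form (Z \<times>\<^sub>M R3) k \<omega>" "closed_form (Z \<times>\<^sub>M R3) k \<omega>"
  shows "closed_form Z k (restrict_to_zero \<omega>)"
  unfolding closed_form_def
proof (intro ballI allI)
  fix c x v assume c: "c \<in> charts Z" and x: "x \<in> coord_range c"
  have "frechet_derivative (\<lambda>y. \<omega> (prod_chart c R3_chart) (y, 0) u) (at x) h =
      frechet_derivative (\<lambda>y. \<omega> (prod_chart c R3_chart) y u) (at (x, 0)) (h, 0)" for u h
    using frechet_derivative_compose_affine[OF bounded_linear_zero_section,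
        of "\<lambda>y. \<omega> (prod_chart c R3_chart) y u" x 0 h]
      diff_form_differentiable[OF \<omega>(1) R3_product_charts[OF c] zero_section_coord[OF x], of u] by simp
  then have "ext_deriv k (restrict_to_zero \<omega>) c x v =
      ext_deriv k \<omega> (prod_chart c R3_chart) (x, 0) (\<lambda>i. (v i, 0))"
    unfolding ext_deriv_def restrict_to_zero_def by simp
  then show "ext_deriv k (restrict_to_zero \<omega>) c x v = 0"
    using \<omega>(2) R3_product_charts[OF c] zero_section_coord[OF x] unfolding closed_form_def by simp
qed

section \<open>Pullback along the first projection\<close>

text \<open>
  A form on a product is a function of product charts, so the pullback of a form on the first
  factor has to recover the chart of that factor from the product chart. Any second argument would
  do in place of \<open>undefined\<close>, since the first component of \<open>map_prod f g\<close> does not depend on it.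
\<close>

definition first_chart :: "('a \<times> 'b, 'e \<times> 'f) chart \<Rightarrow> ('a, 'e) chart" where
  "first_chart C = (fst ` fst C, \<lambda>p. fst (snd C (p, undefined)))"

definition pullback_fst :: "('a, 'e) mform \<Rightarrow> ('a \<times> 'b, 'e \<times> 'f) mform" where
  "pullback_fst \<alpha> C z v = \<alpha> (first_chart C) (fst z) (\<lambda>i. fst (v i))"

lemma first_chart_prod_chart: "fst d \<noteq> {} \<Longrightarrow> first_chart (prod_chart c d) = c"
  by (cases c) (simp add: first_chart_def fst_image_times)

lemma pullback_fst_prod_chart:
  "coord_range d \<noteq> {} \<Longrightarrow> pullback_fst \<alpha> (prod_chart c d) z v = \<alpha> c (fst z) (\<lambda>i. fst (v i))"
  by (simp add: pullback_fst_def first_chart_prod_chart coord_range_def)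

lemma diff_form_pullback_fst:
  assumes M: "oriented_manifold M" and N: "oriented_manifold N" and \<alpha>: "diff_form M k \<alpha>"
  shows "diff_form (M \<times>\<^sub>M N) k (pullback_fst \<alpha>)"
  unfolding diff_form_def
proof (intro conjI ballI allI)
  fix C z v assume "C \<in> charts (M \<times>\<^sub>M N)"
  then obtain c c' where C: "C = prod_chart c c'" and c: "c \<in> charts M" and c': "c' \<in> charts N"
    unfolding charts_prod_manifold by blast
  have ne: "coord_range c' \<noteq> {}" if "z \<in> coord_range C"
    using that unfolding C coord_range_prod_chart by auto
  show "alternating_form k (pullback_fst \<alpha> C z)" if "z \<in> coord_range C"
  proof -
    have "fst z \<in> coord_range c" using that unfolding C coord_range_prod_chart by auto
    from alternating_form_linear_pullback[OF diff_formD(1)[OF \<alpha> c this] bounded_linear.linear[OF bounded_linear_fst]]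
    show ?thesis unfolding C pullback_fst_prod_chart[OF ne[OF that]] .
  qed
  show "smooth_on (coord_range C) (\<lambda>z. pullback_fst \<alpha> C z v)"
    unfolding smooth_on_def
  proof
    fix j
    have op: "open (coord_range C)"
      unfolding C coord_range_prod_chart
      by (intro open_Times oriented_manifoldD(6)[OF M c] oriented_manifoldD(6)[OF N c'])
    show "Ck_on j (coord_range C) (\<lambda>z. pullback_fst \<alpha> C z v)"
    proof (rule Ck_on_cong[OF op])
      show "Ck_on j (coord_range C) (\<lambda>z. \<alpha> c (fst z + 0) (\<lambda>i. fst (v i)))"
      proof (rule Ck_on_compose_affine[OF bounded_linear_fst op])
        show "Ck_on j (coord_range c) (\<lambda>x. \<alpha> c x (\<lambda>i. fst (v i)))"
          using diff_formD(2)[OF \<alpha> c] unfolding smooth_on_def by blast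
        show "fst z + 0 \<in> coord_range c" if "z \<in> coord_range C" for z
          using that unfolding C coord_range_prod_chart by auto
      qed
      show "\<alpha> c (fst z + 0) (\<lambda>i. fst (v i)) = pullback_fst \<alpha> C z v" if "z \<in> coord_range C" for z
      proof -
        have "coord_range c' \<noteq> {}" using that unfolding C coord_range_prod_chart by auto
        then show ?thesis unfolding C add_0_right by (rule pullback_fst_prod_chart[symmetric])
      qed
    qed
  qed
  fix D p assume "D \<in> charts (M \<times>\<^sub>M N)" and p: "p \<in> fst C \<inter> fst D"
  then obtain d d' where D: "D = prod_chart d d'" and d: "d \<in> charts M" and d': "d' \<in> charts N"
    unfolding charts_prod_manifold by blast
  obtain p1 p2 where pp: "p = (p1, p2)" "p1 \<in> fst c \<inter> fst d" "p2 \<in> fst c' \<inter> fst d'"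
    using p unfolding C D by auto
  have ne: "coord_range c' \<noteq> {}" "coord_range d' \<noteq> {}" using pp(3) by (auto simp: coord_range_def)
  show "pullback_fst \<alpha> C (snd C p) v =
     pullback_fst \<alpha> D (snd D p) (\<lambda>i. frechet_derivative (transition C D) (at (snd C p)) (v i))"
    unfolding C D pullback_fst_prod_chart[OF ne(1)] pullback_fst_prod_chart[OF ne(2)]
    using frechet_derivative_transition_prod_chart[OF M c d pp(2) N c' d' pp(3)]
      diff_formD(3)[OF \<alpha> c d pp(2), of "\<lambda>i. fst (v i)"] by (simp add: pp(1))
qed

lemma ext_deriv_pullback_fst:
  assumes \<alpha>: "diff_form M k \<alpha>" and c: "c \<in> charts M" and z: "z \<in> coord_range (prod_chart c d)"
  shows "ext_deriv k (pullback_fst \<alpha>) (prod_chart c d) z v = ext_deriv k \<alpha> c (fst z) (\<lambda>i. fst (v i))"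
proof -
  have x: "fst z \<in> coord_range c" and ne: "coord_range d \<noteq> {}"
    using z unfolding coord_range_prod_chart by auto
  have "frechet_derivative (\<lambda>y. \<alpha> c (fst y) u) (at z) h =
      frechet_derivative (\<lambda>y. \<alpha> c y u) (at (fst z)) (fst h)" for u h
    using frechet_derivative_compose_affine[OF bounded_linear_fst, of "\<lambda>y. \<alpha> c y u" z 0 h]
      diff_form_differentiable[OF \<alpha> c x, of u] by simp
  then show ?thesis
    unfolding ext_deriv_def pullback_fst_prod_chart[OF ne] by simp
qed

lemma closed_form_pullback_fst:
  assumes \<alpha>: "diff_form M k \<alpha>" and "closed_form M k \<alpha>"
  shows "closed_form (M \<times>\<^sub>M N) k (pullback_fst \<alpha>)"
  using assms(2) ext_deriv_pullback_fst[OF \<alpha>] coord_range_prod_chart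
  unfolding closed_form_def charts_prod_manifold by fastforce

section \<open>The area form of the sphere\<close>

text \<open>
  A quarter of the density of the round area with respect to a stereographic coordinate.
\<close>

definition round_density :: "complex \<Rightarrow> real" where
  "round_density w = inverse ((1 + (cmod w)\<^sup>2) * (1 + (cmod w)\<^sup>2))"

text \<open>
  The pullback of the area form to a product with the sphere. The chart does not enter because the
  area form has the same expression in both stereographic coordinates.
\<close>

definition sphere_area :: "('a \<times> (real^3), 'e \<times> complex) mform" where
  "sphere_area C z v = round_density (snd z) * Im (cnj (snd (v 0)) * snd (v 1))"

lemma round_density_pos: "round_density w > 0"
  using one_plus_cmod_pos[of w] by (simp add: round_density_def)

lemma Ck_on_round_density: "Ck_on k UNIV round_density"
proof -
  have "Ck_on k UNIV (\<lambda>w. inverse ((1 + (Re w * Re w + Im w * Im w)) * (1 + (Re w * Re w + Im w * Im w))))"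
    by (intro Ck_on_inverse bounded_bilinear.Ck_on[OF bounded_bilinear_mult] Ck_on_add Ck_on_const
        Ck_on_bounded_linear bounded_linear_Re bounded_linear_Im open_UNIV)
      (metis add_pos_nonneg less_irrefl mult_eq_0_iff sum_squares_ge_zero zero_less_one)
  moreover have "round_density = (\<lambda>w. inverse ((1 + (Re w * Re w + Im w * Im w)) * (1 + (Re w * Re w + Im w * Im w))))"
    unfolding round_density_def cmod_power2 by (simp add: power2_eq_square)
  ultimately show ?thesis by simp
qed

lemma alternating_form_area: "alternating_form 2 (\<lambda>v. r * Im (cnj (v 0) * v 1))"
proof -
  have "linear (\<lambda>u. r * Im (cnj ((v(i := u)) 0) * (v(i := u)) 1))" if "i < 2" for v :: "nat \<Rightarrow> complex" and i
    using that by (auto simp: less_2_cases_iff intro!: linearI) (auto simp: algebra_simps)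
  then show ?thesis
    unfolding alternating_form_def by (auto simp: less_2_cases_iff)
qed

text \<open>
  Compatibility with the transition maps amounts to \<open>\<rho>(1 / w) \<bar>a\<bar>\<^sup>2 = \<rho>(w)\<close> for the density \<open>\<rho>\<close>
  and the derivative \<open>a\<close> of \<open>w \<mapsto> 1 / w\<close>.
\<close>

lemma diff_form_sphere_area:
  fixes M :: "('a, 'e::euclidean_space) manifold"
  assumes M: "oriented_manifold M"
  shows "diff_form (M \<times>\<^sub>M S2) 2 sphere_area"
  unfolding diff_form_def
proof (intro conjI ballI allI)
  fix C and z :: "'e \<times> complex" and v :: "nat \<Rightarrow> 'e \<times> complex"
  assume "C \<in> charts (M \<times>\<^sub>M S2)"
  then obtain c c' where C: "C = prod_chart c c'" and c: "c \<in> charts M" and c': "c' \<in> charts S2"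
    unfolding charts_prod_manifold by blast
  show "alternating_form 2 (sphere_area C z)"
    using alternating_form_linear_pullback[OF alternating_form_area bounded_linear.linear[OF bounded_linear_snd]]
    unfolding sphere_area_def .
  have op: "open (coord_range C)"
    unfolding C coord_range_prod_chart
    by (intro open_Times oriented_manifoldD(6)[OF M c] oriented_manifoldD(6)[OF oriented_manifold_S2 c'])
  have "Ck_on j (coord_range C) (\<lambda>z. round_density (snd z + 0) * Im (cnj (snd (v 0)) * snd (v 1)))" for j
    by (intro bounded_bilinear.Ck_on[OF bounded_bilinear_mult] Ck_on_const op
        Ck_on_compose_affine[OF bounded_linear_snd op UNIV_I Ck_on_round_density])
  then show "smooth_on (coord_range C) (\<lambda>z. sphere_area C z v)"
    unfolding smooth_on_def sphere_area_def by simp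
  fix D p assume "D \<in> charts (M \<times>\<^sub>M S2)" and p: "p \<in> fst C \<inter> fst D"
  then obtain d d' where D: "D = prod_chart d d'" and d: "d \<in> charts M" and d': "d' \<in> charts S2"
    unfolding charts_prod_manifold by blast
  obtain p1 p2 where pp: "p = (p1, p2)" "p1 \<in> fst c \<inter> fst d" "p2 \<in> fst c' \<inter> fst d'"
    using p unfolding C D by auto
  let ?w = "snd c' p2"
  have "?w \<in> snd c' ` (fst c' \<inter> fst d')" using pp(3) by blast
  from S2_transition_conformal[OF c' d' this]
  obtain a where a: "a \<noteq> 0" "frechet_derivative (transition c' d') (at ?w) = (\<lambda>h. a * h)"
    "cmod a * (1 + (cmod ?w)\<^sup>2) = 1 + (cmod (transition c' d' ?w))\<^sup>2" by metis
  have t: "transition c' d' ?w = snd d' p2"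
    by (rule transition_apply[OF chart_inj_on[OF oriented_manifold_S2 c']]) (use pp in blast)
  have cancel: "inverse ((A * X) * (A * X)) * A\<^sup>2 = inverse (X * X)" if "A \<noteq> 0" "X \<noteq> 0" for A X :: real
    using that by (simp add: field_simps power2_eq_square)
  have "round_density (snd d' p2) * (cmod a)\<^sup>2 = round_density ?w"
    unfolding round_density_def t[symmetric] a(3)[symmetric]
    by (rule cancel) (use a(1) one_plus_cmod_pos[of ?w] in auto)
  moreover have "Im (cnj (a * h) * (a * k)) = (cmod a)\<^sup>2 * Im (cnj h * k)" for h k
    unfolding cmod_power2 by (simp add: algebra_simps power2_eq_square)
  ultimately show "sphere_area C (snd C p) v =
     sphere_area D (snd D p) (\<lambda>i. frechet_derivative (transition C D) (at (snd C p)) (v i))"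
    using frechet_derivative_transition_prod_chart[OF M c d pp(2) oriented_manifold_S2 c' d' pp(3)]
    unfolding C D sphere_area_def by (simp add: pp(1) a(2) mult.assoc[symmetric])
qed

text \<open>
  The exterior derivative is the alternating 3-form \<open>d\<rho> \<and> dx \<and> dy\<close> pulled back from the plane,
  where three vectors are linearly dependent. Expanding \<open>d\<rho>\<close> in \<open>dx\<close> and \<open>dy\<close> makes the terms cancel.
\<close>

lemma closed_form_sphere_area:
  fixes N :: "('a \<times> (real^3), 'e::euclidean_space \<times> complex) manifold"
  shows "closed_form N 2 sphere_area"
  unfolding closed_form_def
proof (intro ballI allI)
  fix C :: "('a \<times> (real^3), 'e \<times> complex) chart" and z :: "'e \<times> complex"
    and v :: "nat \<Rightarrow> 'e \<times> complex"
  let ?D = "frechet_derivative round_density (at (snd z))"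
  have diff: "round_density differentiable (at w)" for w
    using Ck_on_round_density[of 1] by simp
  then have lin: "linear ?D" by (rule linear_frechet_derivative)
  have D: "?D h = Re h * ?D 1 + Im h * ?D \<i>" for h
  proof -
    have "h = Re h *\<^sub>R 1 + Im h *\<^sub>R \<i>" by (simp add: complex_eq_iff)
    then have "?D h = ?D (Re h *\<^sub>R 1 + Im h *\<^sub>R \<i>)" by simp
    then show ?thesis by (simp only: linear_add[OF lin] linear_scale[OF lin]) simp
  qed
  have "((\<lambda>y. round_density (snd y)) has_derivative (\<lambda>h. ?D (snd h))) (at z)"
    using has_derivative_compose[OF bounded_linear_imp_has_derivative[OF bounded_linear_snd]
        diff[unfolded frechet_derivative_works]] .
  from frechet_derivative_at[OF has_derivative_mult_left[OF this]]
  have "frechet_derivative (\<lambda>y. round_density (snd y) * K) (at z) h = ?D (snd h) * K" for K :: real and h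
    by metis
  then have "ext_deriv 2 sphere_area C z v =
      ?D (snd (v 0)) * Im (cnj (snd (v 1)) * snd (v 2)) - ?D (snd (v 1)) * Im (cnj (snd (v 0)) * snd (v 2)) +
      ?D (snd (v 2)) * Im (cnj (snd (v 0)) * snd (v 1))"
    unfolding ext_deriv_def sphere_area_def by (simp add: numeral_2_eq_2)
  also have "\<dots> = 0"
    unfolding D[of "snd (v _)"] by (simp add: algebra_simps)
  finally show "ext_deriv 2 sphere_area C z v = 0" .
qed

section \<open>The stable Hamiltonian structure\<close>

text \<open>
  The product of a closed 2-form that \<open>\<epsilon>\<close> stabilizes with the area form of the sphere. Positivity is
  \<open>wedge_extra_plane\<close> for the product frame, with the area \<open>round_density\<close> of the frame of the
  sphere as \<open>s\<close>.
\<close>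

lemma stable_hamiltonian_structure_times_S2:
  fixes Z :: "('a, 'e::euclidean_space) manifold"
  assumes Z: "oriented_manifold Z" and dim: "DIM('e) = 2 * m + 1"
    and \<tau>: "diff_form Z 2 \<tau>" "closed_form Z 2 \<tau>" and \<epsilon>: "stabilizing_form Z (Suc m) \<tau> \<epsilon>"
  shows "stable_hamiltonian_structure (Z \<times>\<^sub>M S2) (Suc (Suc m))
     (\<lambda>C z v. pullback_fst \<tau> C z v + sphere_area C z v) (pullback_fst \<epsilon>)"
proof -
  let ?N = "Z \<times>\<^sub>M S2"
  let ?\<Omega> = "\<lambda>C z v. pullback_fst \<tau> C z v + sphere_area C z v"
  let ?\<mu> = "pullback_fst \<epsilon> :: ('a \<times> (real^3), 'e \<times> complex) mform"
  have \<epsilon>1: "diff_form Z 1 \<epsilon>" using \<epsilon> by (simp add: stabilizing_form_def)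
  have N: "oriented_manifold ?N" by (rule oriented_manifold_prod[OF Z oriented_manifold_S2])
  have \<Omega>: "diff_form ?N 2 ?\<Omega>"
    by (intro diff_form_add N diff_form_pullback_fst Z oriented_manifold_S2 \<tau> diff_form_sphere_area)
  have \<Omega>_closed: "closed_form ?N 2 ?\<Omega>"
    by (intro closed_form_add N diff_form_pullback_fst Z oriented_manifold_S2 \<tau> diff_form_sphere_area
        closed_form_pullback_fst closed_form_sphere_area)
  have \<mu>: "diff_form ?N 1 ?\<mu>"
    by (intro diff_form_pullback_fst Z oriented_manifold_S2 \<epsilon>1)
  have fr: "frame ?N = (\<lambda>i. if i < 2 * m + 1 then (frame Z i, 0) else (0, frame S2 (i - (2 * m + 1))))"
    unfolding frame_prod_manifold dim ..
  have S2_frame: "frame S2 0 = 1" "frame S2 1 = \<i>" by (simp_all add: S2_def)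
  have main: "wedge 1 (2 * Suc m) (?\<mu> C z) (wedge_power (?\<Omega> C z) (Suc m)) (frame ?N) > 0 \<and>
      kernel2 (?\<Omega> C z) \<subseteq> kernel2 (ext_deriv 1 ?\<mu> C z)"
    if Cz: "C \<in> charts ?N" "z \<in> coord_range C" for C z
  proof -
    obtain c d where C: "C = prod_chart c d" and c: "c \<in> charts Z" and d: "d \<in> charts S2"
      using Cz(1) unfolding charts_prod_manifold by blast
    have x: "fst z \<in> coord_range c" and ne: "coord_range d \<noteq> {}"
      using Cz(2) unfolding C coord_range_prod_chart by auto
    have \<tau>_alt: "alternating_form 2 (\<tau> c (fst z))" and \<epsilon>_alt: "alternating_form 1 (\<epsilon> c (fst z))"
      by (rule diff_formD(1)[OF \<tau>(1) c x] diff_formD(1)[OF \<epsilon>1 c x])+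
    have \<mu>_eq: "?\<mu> C z v = \<epsilon> c (fst z) (\<lambda>i. fst (v i))" for v
      unfolding C by (rule pullback_fst_prod_chart[OF ne])
    have \<Omega>_eq: "?\<Omega> C z (vpair u w) = \<tau> c (fst z) (vpair (fst u) (fst w)) +
        round_density (snd z) * Im (cnj (snd u) * snd w)" for u w
      unfolding C pullback_fst_prod_chart[OF ne] sphere_area_def vpair_comp by (simp add: vpair_def)
    have \<tau>_zero: "\<tau> c (fst z) (vpair 0 u) = 0" "\<tau> c (fst z) (vpair u 0) = 0" for u
      using alternating_form_zero[OF \<tau>_alt, of 0 "vpair 0 u"] alternating_form_zero[OF \<tau>_alt, of 1 "vpair u 0"]
      by (simp_all add: vpair_def)
    have "wedge 1 (2 * Suc m) (?\<mu> C z) (wedge_power (?\<Omega> C z) (Suc m)) (frame ?N) =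
        real (Suc m) * round_density (snd z) *
          wedge 1 (2 * m) (\<epsilon> c (fst z)) (wedge_power (\<tau> c (fst z)) m) (frame Z)"
    proof (rule wedge_extra_plane)
      show "alternating_form 1 (?\<mu> C z)" by (rule diff_formD(1)[OF \<mu> Cz])
      show "alternating_form 2 (?\<Omega> C z)" by (rule diff_formD(1)[OF \<Omega> Cz])
      show "?\<mu> C z (\<lambda>_. frame ?N (2 * m + 1)) = 0" "?\<mu> C z (\<lambda>_. frame ?N (2 * m + 1 + 1)) = 0"
        unfolding \<mu>_eq fr by (rule alternating_form_zero[OF \<epsilon>_alt, of 0]; simp)+
      show "?\<Omega> C z (vpair (frame ?N (2 * m + 1)) (frame ?N (2 * m + 1 + 1))) = round_density (snd z)"
        "?\<Omega> C z (vpair (frame ?N (2 * m + 1 + 1)) (frame ?N (2 * m + 1))) = - round_density (snd z)"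
        unfolding \<Omega>_eq fr using S2_frame by (simp_all add: \<tau>_zero)
    qed (use \<epsilon>_alt \<tau>_alt in \<open>simp_all add: \<mu>_eq \<Omega>_eq fr \<tau>_zero\<close>)
    also have "\<dots> > 0"
      using \<epsilon> c x round_density_pos[of "snd z"] by (simp add: stabilizing_form_def)
    finally have pos: "wedge 1 (2 * Suc m) (?\<mu> C z) (wedge_power (?\<Omega> C z) (Suc m)) (frame ?N) > 0" .
    have "kernel2 (?\<Omega> C z) \<subseteq> kernel2 (ext_deriv 1 ?\<mu> C z)"
    proof
      fix u assume u: "u \<in> kernel2 (?\<Omega> C z)"
      \<comment> \<open>Test vectors tangent to the first factor do not see the area form.\<close>
      have "\<tau> c (fst z) (vpair (fst u) w) = 0" for w
      proof -
        have "?\<Omega> C z (vpair u (w, 0)) = 0" using u by (simp add: kernel2_def)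
        then show ?thesis unfolding \<Omega>_eq by simp
      qed
      then have "fst u \<in> kernel2 (\<tau> c (fst z))" by (simp add: kernel2_def)
      then have "fst u \<in> kernel2 (ext_deriv 1 \<epsilon> c (fst z))"
        using \<epsilon> c x unfolding stabilizing_form_def by blast
      then show "u \<in> kernel2 (ext_deriv 1 ?\<mu> C z)"
        unfolding kernel2_def C ext_deriv_pullback_fst[OF \<epsilon>1 c Cz(2)[unfolded C]] vpair_comp by simp
    qed
    with pos show ?thesis ..
  qed
  have "\<exists>v. wedge_power (?\<Omega> C z) (Suc m) v \<noteq> 0" if "C \<in> charts ?N" "z \<in> coord_range C" for C z
  proof (rule ccontr)
    assume "\<nexists>v. wedge_power (?\<Omega> C z) (Suc m) v \<noteq> 0"
    then have "wedge 1 (2 * Suc m) (?\<mu> C z) (wedge_power (?\<Omega> C z) (Suc m)) (frame ?N) = 0"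
      by (simp only: wedge_def not_ex not_not mult_zero_right sum.neutral_const div_0)
    with main[OF that] show False by linarith
  qed
  then show ?thesis
    unfolding stable_hamiltonian_structure_def hamiltonian_structure_def stabilizing_form_def
    using N \<Omega> \<Omega>_closed \<mu> main by (simp add: dim)
qed

theorem proposition4p3:
  fixes Z :: "('a, 'e::euclidean_space) manifold"
    and n :: nat
    and \<omega> :: "('a \<times> (real^3), 'e \<times> (real^3)) mform"
    and \<epsilon> :: "('a, 'e) mform"
  assumes "n \<ge> 1"
    and "oriented_manifold Z"
    and "DIM('e) = 2 * n - 1"
    and "near_symplectic (Z \<times>\<^sub>M R3) (n + 1) \<omega>"
    and "singular_locus (Z \<times>\<^sub>M R3) (n + 1) \<omega> = topspace (mtop Z) \<times> {0}"
    and "stabilizing_form Z n (restrict_to_zero \<omega>) \<epsilon>"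
  shows "\<exists>\<Omega> \<mu>. stable_hamiltonian_structure (Z \<times>\<^sub>M S2) (n + 1) \<Omega> \<mu>"
proof -
  obtain m where m: "n = Suc m" using \<open>n \<ge> 1\<close> by (cases n) auto
  have \<omega>: "diff_form (Z \<times>\<^sub>M R3) 2 \<omega>" "closed_form (Z \<times>\<^sub>M R3) 2 \<omega>"
    using assms(4) by (simp_all add: near_symplectic_def)
  have "stable_hamiltonian_structure (Z \<times>\<^sub>M S2) (Suc (Suc m))
     (\<lambda>C z v. pullback_fst (restrict_to_zero \<omega>) C z v + sphere_area C z v) (pullback_fst \<epsilon>)"
    using assms(3,6) m
    by (intro stable_hamiltonian_structure_times_S2 assms(2) diff_form_restrict_to_zero
        closed_form_restrict_to_zero \<omega>) auto
  then show ?thesis using m by auto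
qed

end
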